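(* Let $B$ be a Blaschke product. Then $B'\in H^{1}_{w}$ if and only if $B$ is an exponential Blaschke product.
   Context: Let $\mathbb{D}$ be the open unit disc of the complex plane and $\partial\mathbb{D}$ the unit circle; $|E|$ denotes the length of a measurable set $E\subset\partial\mathbb{D}$. A Blaschke product is a (finite or infinite) product $B(z)=\prod_{n}\frac{\overline{z}_{n}}{|z_{n}|}\frac{z_{n}-z}{1-\overline{z}_{n}z}$, $z\in\mathbb{D}$, with zeros $z_n\in\mathbb{D}$ (repeated according to multiplicity) satisfying $\sum_n(1-|z_n|)<\infty$, with the convention $\overline{z}/|z|=1$ if $z=0$. For $0<p<\infty$, the weak Hardy space $H^{p}_{w}$ consists of those analytic functions $f$ in $\mathbb{D}$ for which there exists a constant $C=C(f)>0$ such that $|\{e^{i\theta}: |f(re^{i\theta})|>\lambda\}|\le C\lambda^{-p}$ for any $0<r<1$ and any $\lambda>0$. A Blaschke product $B$ is called an exponential Blaschke product if there exists a constant $M=M(B)>0$ such that for any $k=1,2,\dotsc$ one has $\#\{z: B(z)=0,\ 2^{-k-1}\le 1-|z|\le 2^{-k}\}\le M$, where zeros are counted with multiplicity. *)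

theory Defs
  imports "HOL-Complex_Analysis.Complex_Analysis"
begin

definition blaschke_factor :: "complex \<Rightarrow> complex \<Rightarrow> complex" where
  "blaschke_factor a w =
     (if a = 0 then 1 else cnj a / of_real (norm a)) * ((a - w) / (1 - cnj a * w))"

text \<open>
  The zeros are the family \<open>(a n)\<close> with \<open>n \<in> I\<close>, where \<open>I\<close> is an arbitrary set of
  natural numbers, so that finite (even empty) and infinite products are both covered and zeros
  may be repeated. Nothing is required of \<open>B\<close> outside the open unit disc.
\<close>

definition blaschke_product :: "(complex \<Rightarrow> complex) \<Rightarrow> bool" where
  "blaschke_product B \<longleftrightarrow>
     (\<exists>(I :: nat set) (a :: nat \<Rightarrow> complex).
        (\<forall>n\<in>I. a n \<in> ball 0 1) \<and>
        (\<lambda>n. 1 - norm (a n)) summable_on I \<and>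
        (\<forall>w\<in>ball 0 1. (\<lambda>n. if n \<in> I then blaschke_factor (a n) w else 1) has_prod B w))"

definition circle_length :: "complex set \<Rightarrow> real" where
  "circle_length E = measure lebesgue {t \<in> {0..<2 * pi}. cis t \<in> E}"

text \<open>Meaningful for \<open>p > 0\<close>.\<close>

definition weak_hardy :: "real \<Rightarrow> (complex \<Rightarrow> complex) set" where
  "weak_hardy p =
     {f. f analytic_on ball 0 1 \<and>
         (\<exists>C>0. \<forall>r l. 0 < r \<longrightarrow> r < 1 \<longrightarrow> 0 < l \<longrightarrow>
            circle_length {u \<in> sphere 0 1. norm (f (of_real r * u)) > l} \<le> C * l powr (-p))}"

definition dyadic_zeros :: "(complex \<Rightarrow> complex) \<Rightarrow> nat \<Rightarrow> complex set" where
  "dyadic_zeros B k =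
     {z \<in> ball 0 1. B z = 0 \<and> 1 / 2 ^ (k + 1) \<le> 1 - norm z \<and> 1 - norm z \<le> 1 / 2 ^ k}"

text \<open>
  The sum of the orders \<open>zorder B z\<close> counts the zeros with multiplicity; finiteness is stated
  because \<open>sum\<close> is \<open>0\<close> on infinite sets.
\<close>

definition exponential_blaschke_product :: "(complex \<Rightarrow> complex) \<Rightarrow> bool" where
  "exponential_blaschke_product B \<longleftrightarrow>
     blaschke_product B \<and>
     (\<exists>M::real. M > 0 \<and>
        (\<forall>k\<ge>1. finite (dyadic_zeros B k) \<and>
                (\<Sum>z\<in>dyadic_zeros B k. of_int (zorder B z)) \<le> M))"

end

theory Submission
  imports Defs
begin

text \<open>
  Write \<open>d\<^sub>n = 1 - |a\<^sub>n|\<close> for the distances of the zeros to the circle.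

  If every dyadic annulus contains at most \<open>M\<close> zeros, bound \<open>|B'|\<close> by the sum of the moduli of the
  derivatives of the factors. Given \<open>K\<close>, the zeros with \<open>d\<^sub>n \<ge> 2 ^ (-K)\<close> contribute \<open>O(M 2 ^ K)\<close>
  everywhere. A zero with \<open>d\<^sub>n ~ 2 ^ (-k)\<close>, \<open>k > K\<close>, is cut out by an arc of length comparable to
  \<open>2 ^ (-K) (3/4) ^ (k - K)\<close>; these arcs have total length \<open>O(M 2 ^ (-K))\<close>, and since \<open>(3/4)\<^sup>2 > 1/2\<close>
  the contributions off the arcs still add up to \<open>O(M 2 ^ K)\<close>.

  Conversely, suppose \<open>|B| \<le> 1 - c\<close> on the part of the circle of radius \<open>1 - d\<close> lying over a set \<open>S\<close>
  of angles. As \<open>|B|\<close> tends to 1 in mean at the boundary, \<open>c |S|\<close> is at most the integral of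
  \<open>|B'|\<close> over the region above \<open>S\<close> between radius \<open>1 - d\<close> and 1. The weak type inequality on each
  circle, truncated by \<open>|B'(z)| \<le> 1 / (1 - |z|)\<close>, bounds this integral by \<open>c |S| / 2 + O(d)\<close>, so
  \<open>|S| = O(d)\<close>. Divide the circle into \<open>2 ^ k\<close> arcs. Over an arc containing \<open>m\<close> zeros of the \<open>k\<close>-th
  annulus the hypothesis holds with \<open>d = 2 ^ (-k) / m\<close>, whence \<open>m = O(1)\<close>; over the union of
  all arcs containing such a zero it holds with \<open>d = 2 ^ (-k)\<close>, so there are \<open>O(1)\<close> such arcs.
\<close>

section \<open>Blaschke factors and products\<close>

lemma norm_one_minus_ge:
  fixes a w :: complex
  assumes "norm a < 1" "norm w < 1"
  shows "1 - norm w \<le> norm (1 - cnj a * w)" "1 - norm a \<le> norm (1 - cnj a * w)"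
    "1 - cnj a * w \<noteq> 0"
proof -
  have "norm (cnj a * w) \<le> norm w" "norm (cnj a * w) \<le> norm a"
    using assms by (simp_all add: norm_mult mult_left_le_one_le mult_right_le_one_le)
  moreover have "1 - norm (cnj a * w) \<le> norm (1 - cnj a * w)"
    by (metis norm_one norm_triangle_ineq2)
  ultimately show 1: "1 - norm w \<le> norm (1 - cnj a * w)" "1 - norm a \<le> norm (1 - cnj a * w)"
    by linarith+
  show "1 - cnj a * w \<noteq> 0"
    using 1(1) assms(2) by auto
qed

lemma norm_blaschke_factor:
  "norm (blaschke_factor a w) = norm (a - w) / norm (1 - cnj a * w)"
  by (simp add: blaschke_factor_def norm_mult norm_divide)

text \<open>This identity serves three purposes: it shows that the factors are contractions, it
  bounds their defect from 1 above on circles near the boundary, and it bounds that defect below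
  close to the zeros.\<close>

lemma one_minus_norm_blaschke_factor_sq:
  assumes "norm a < 1" "norm w < 1"
  shows "1 - (norm (blaschke_factor a w))\<^sup>2 =
           (1 - (norm a)\<^sup>2) * (1 - (norm w)\<^sup>2) / (norm (1 - cnj a * w))\<^sup>2"
proof -
  have "(norm (1 - cnj a * w))\<^sup>2 - (norm (a - w))\<^sup>2 = (1 - (norm a)\<^sup>2) * (1 - (norm w)\<^sup>2)"
    unfolding cmod_power2 by (simp add: power2_eq_square algebra_simps)
  then show ?thesis
    using norm_one_minus_ge(3)[OF assms]
    by (simp add: norm_blaschke_factor power_divide field_simps)
qed

lemma norm_blaschke_factor_le_1:
  assumes "norm a < 1" "norm w < 1"
  shows "norm (blaschke_factor a w) \<le> 1"
proof -
  have "0 \<le> 1 - (norm (blaschke_factor a w))\<^sup>2"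
    unfolding one_minus_norm_blaschke_factor_sq[OF assms]
    using assms by (intro divide_nonneg_nonneg mult_nonneg_nonneg) (auto simp: power_le_one)
  then show ?thesis
    by (simp add: power_le_one_iff)
qed

lemma blaschke_factor_eq_0_iff:
  assumes "norm a < 1" "norm w < 1"
  shows "blaschke_factor a w = 0 \<longleftrightarrow> w = a"
  using norm_one_minus_ge(3)[OF assms] by (auto simp: blaschke_factor_def)

lemma norm_blaschke_factor_0: "norm (blaschke_factor a 0) = norm a"
  by (simp add: norm_blaschke_factor)

text \<open>The unimodular normalisation lets \<open>1 - norm a\<close> be split off from the
  difference, so the Blaschke condition yields absolute convergence of the product.\<close>

lemma norm_blaschke_factor_minus_1_le:
  assumes "norm a < 1" "norm w < 1"
  shows "norm (blaschke_factor a w - 1) \<le> 2 / (1 - norm w) * (1 - norm a)"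
proof (cases "a = 0")
  case True
  have "norm (- w - 1) \<le> norm w + 1"
    by (metis norm_minus_cancel norm_one norm_triangle_ineq4)
  also have "\<dots> \<le> 2 / (1 - norm w)"
    using assms by (simp add: field_simps)
  finally show ?thesis
    using True by (simp add: blaschke_factor_def)
next
  case False
  let ?q = "1 - cnj a * w"
  have q: "?q \<noteq> 0" "1 - norm w \<le> norm ?q"
    using norm_one_minus_ge assms by auto
  \<comment> \<open>Clearing both denominators lets the difference factor; the common
    \<open>norm a\<close> cancels at the end.\<close>
  have "(blaschke_factor a w - 1) * (of_real (norm a) * ?q)
      = cnj a * a - cnj a * w - of_real (norm a) + of_real (norm a) * cnj a * w"
    using False q by (simp add: blaschke_factor_def field_simps)
  also have "cnj a * a = of_real (norm a) * of_real (norm a)"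
    using complex_norm_square[of a] by (simp add: mult.commute power2_eq_square)
  also have "of_real (norm a) * of_real (norm a) - cnj a * w - of_real (norm a)
                + of_real (norm a) * cnj a * w
      = - (of_real (norm a) + cnj a * w) * of_real (1 - norm a)"
    by (simp add: algebra_simps)
  finally have "norm (blaschke_factor a w - 1) * (norm a * norm ?q)
      = norm (complex_of_real (norm a) + cnj a * w) * (1 - norm a)"
    using assms by (metis (no_types, lifting) abs_norm_cancel abs_of_pos diff_gt_0_iff_gt norm_minus_cancel norm_mult norm_of_real)
  also have "\<dots> \<le> (norm a * 2) * (1 - norm a)"
  proof (rule mult_right_mono)
    have "norm (complex_of_real (norm a) + cnj a * w) \<le> norm a + norm a * norm w"
      by (rule norm_triangle_le) (simp add: norm_mult)
    also have "\<dots> \<le> norm a * 2"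
      using mult_left_mono[of "norm w" 1 "norm a"] assms by simp
    finally show "norm (complex_of_real (norm a) + cnj a * w) \<le> norm a * 2" .
  qed (use assms in simp)
  finally have "norm (blaschke_factor a w - 1) * norm ?q \<le> 2 * (1 - norm a)"
    using False by (simp add: mult.left_commute mult.assoc)
  moreover have "norm (blaschke_factor a w - 1) * (1 - norm w)
      \<le> norm (blaschke_factor a w - 1) * norm ?q"
    using q by (intro mult_left_mono) auto
  ultimately show ?thesis
    using assms by (simp add: field_simps)
qed

lemma holomorphic_on_blaschke_factor [holomorphic_intros]:
  "norm a < 1 \<Longrightarrow> blaschke_factor a holomorphic_on ball 0 1"
  unfolding blaschke_factor_def
  by (intro holomorphic_intros) (use norm_one_minus_ge(3) in auto)

lemma norm_deriv_blaschke_factor: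
  assumes "norm a < 1" "norm w < 1"
  shows "norm (deriv (blaschke_factor a) w) = (1 - (norm a)\<^sup>2) / (norm (1 - cnj a * w))\<^sup>2"
proof -
  define u where "u = (if a = 0 then 1 else cnj a / of_real (norm a))"
  have [simp]: "norm u = 1"
    by (simp add: u_def norm_divide)
  let ?q = "1 - cnj a * w"
  have q: "?q \<noteq> 0"
    using norm_one_minus_ge assms by auto
  have "blaschke_factor a = (\<lambda>w. u * ((a - w) / (1 - cnj a * w)))"
    by (simp add: fun_eq_iff blaschke_factor_def u_def)
  moreover have "((\<lambda>w. u * ((a - w) / (1 - cnj a * w))) has_field_derivative
      u * ((- 1 * (1 - cnj a * w) - (a - w) * (- cnj a)) / (?q * ?q))) (at w)"
    using q by (auto intro!: derivative_eq_intros simp: algebra_simps)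
  ultimately have "deriv (blaschke_factor a) w = u * ((- 1 * ?q - (a - w) * (- cnj a)) / (?q * ?q))"
    by (simp add: DERIV_imp_deriv)
  also have "- 1 * ?q - (a - w) * (- cnj a) = - of_real (1 - (norm a)\<^sup>2)"
    using complex_norm_square[of a] by (simp add: algebra_simps)
  finally have "norm (deriv (blaschke_factor a) w) = \<bar>1 - (norm a)\<^sup>2\<bar> / (norm ?q)\<^sup>2"
    by (simp only: norm_mult norm_divide norm_minus_cancel norm_of_real \<open>norm u = 1\<close> power2_eq_square mult_1)
  then show ?thesis
    using assms by (simp add: power_le_one)
qed

section \<open>The product: convergence, derivative bounds and orders of zeros\<close>

locale blaschke_zeros =
  fixes I :: "nat set" and a :: "nat \<Rightarrow> complex"
  assumes zero_norm_less_1: "n \<in> I \<Longrightarrow> norm (a n) < 1"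
    and summable_on_zeros: "(\<lambda>n. 1 - norm (a n)) summable_on I"
begin

text \<open>Indices outside \<open>I\<close> carry the neutral factor 1, so that products run over
  all natural numbers; \<open>depth\<close> is 0 there for the same reason.\<close>

definition fac :: "nat \<Rightarrow> complex \<Rightarrow> complex" where
  "fac n w = (if n \<in> I then blaschke_factor (a n) w else 1)"

definition depth :: "nat \<Rightarrow> real" where
  "depth n = (if n \<in> I then 1 - norm (a n) else 0)"

definition bprod :: "complex \<Rightarrow> complex" where
  "bprod w = prodinf (\<lambda>n. fac n w)"

lemma depth_bounds: "0 \<le> depth n" "depth n \<le> 1"
  using zero_norm_less_1[of n] by (auto simp: depth_def)

lemma depth_pos: "n \<in> I \<Longrightarrow> 0 < depth n"
  using zero_norm_less_1[of n] by (auto simp: depth_def)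

lemma summable_depth: "summable depth"
proof -
  have "depth summable_on UNIV \<longleftrightarrow> (\<lambda>n. 1 - norm (a n)) summable_on I"
    by (rule summable_on_cong_neutral) (auto simp: depth_def)
  then show ?thesis
    using summable_on_zeros summable_on_imp_summable by blast
qed

lemma norm_fac_le_1: "norm w < 1 \<Longrightarrow> norm (fac n w) \<le> 1"
  using norm_blaschke_factor_le_1 zero_norm_less_1 by (simp add: fac_def)

lemma norm_fac_minus_1_le:
  "norm w < 1 \<Longrightarrow> norm (fac n w - 1) \<le> 2 / (1 - norm w) * depth n"
  using norm_blaschke_factor_minus_1_le[of "a n" w] zero_norm_less_1[of n]
  by (simp add: fac_def depth_def)

lemma fac_holomorphic [holomorphic_intros]: "fac n holomorphic_on ball 0 1"
  using zero_norm_less_1[of n]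
  by (cases "n \<in> I") (auto simp: fac_def[abs_def] intro!: holomorphic_intros)

lemma has_prod_fac:
  assumes "norm w < 1"
  shows "(\<lambda>n. fac n w) has_prod bprod w"
proof -
  have "summable (\<lambda>n. norm (fac n w - 1))"
    by (rule summable_comparison_test'[of "\<lambda>n. 2 / (1 - norm w) * depth n"])
       (use norm_fac_minus_1_le[OF assms] in \<open>auto intro!: summable_mult summable_depth\<close>)
  then have "convergent_prod (\<lambda>n. fac n w)"
    by (intro abs_convergent_prod_imp_convergent_prod summable_imp_abs_convergent_prod)
  then show ?thesis
    unfolding bprod_def by (rule convergent_prod_has_prod)
qed

lemma partial_prod_tendsto:
  "norm w < 1 \<Longrightarrow> (\<lambda>N. \<Prod>n<N. fac n w) \<longlonglongrightarrow> bprod w"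
  by (rule has_prod_imp_tendsto'[OF has_prod_fac])

lemma uniform_limit_partial_prod:
  assumes "0 < R" "R < 1"
  shows "uniform_limit (cball 0 R) (\<lambda>N w. \<Prod>n<N. fac n w) bprod sequentially"
proof -
  have "uniformly_convergent_on (cball 0 R) (\<lambda>N w. \<Prod>n<N. fac n w)"
  proof (rule uniformly_convergent_on_prod')
    show "continuous_on (cball 0 R) (fac n)" for n
      by (rule holomorphic_on_imp_continuous_on, rule holomorphic_on_subset[OF fac_holomorphic])
         (use assms in auto)
    show "uniformly_convergent_on (cball 0 R) (\<lambda>N w. \<Sum>n<N. norm (fac n w - 1))"
    proof (rule Weierstrass_m_test')
      show "norm (norm (fac n w - 1)) \<le> 2 / (1 - R) * depth n" if "w \<in> cball 0 R" for n w
      proof -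
        have "norm (fac n w - 1) \<le> 2 / (1 - norm w) * depth n"
          using that assms by (intro norm_fac_minus_1_le) auto
        also have "\<dots> \<le> 2 / (1 - R) * depth n"
          using that assms depth_bounds by (intro mult_right_mono divide_left_mono) auto
        finally show ?thesis by simp
      qed
    qed (intro summable_mult summable_depth)
  qed auto
  then have "uniform_limit (cball 0 R) (\<lambda>N w. \<Prod>n<N. fac n w)
      (\<lambda>w. lim (\<lambda>N. \<Prod>n<N. fac n w)) sequentially"
    by (simp add: uniformly_convergent_uniform_limit_iff)
  moreover have "lim (\<lambda>N. \<Prod>n<N. fac n w) = bprod w" if "w \<in> cball 0 R" for w
    using partial_prod_tendsto[of w] that assms by (intro limI) auto
  ultimately show ?thesis
    using uniform_limit_cong'[of "cball 0 R"] by (metis (no_types, lifting))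
qed

text \<open>Small closed discs lie in some \<open>cball 0 R\<close> with \<open>R < 1\<close>. This
  local form serves both holomorphy of the limit and convergence of the derivatives.\<close>

lemma locally_uniform_limit_partial_prod:
  assumes "w \<in> ball 0 1"
  shows "\<exists>d>0. cball w d \<subseteq> ball 0 1 \<and>
           uniform_limit (cball w d) (\<lambda>N w. \<Prod>n<N. fac n w) bprod sequentially"
proof (intro exI conjI)
  let ?d = "(1 - norm w) / 2"
  show "?d > 0" using assms by simp
  have sub: "cball w ?d \<subseteq> cball 0 ((1 + norm w) / 2)"
  proof
    fix z assume "z \<in> cball w ?d"
    then have "norm (z - w) \<le> ?d"
      by (simp add: dist_norm norm_minus_commute)
    then have "norm z \<le> norm w + ?d"
      using norm_triangle_sub[of z w] by linarith
    then show "z \<in> cball 0 ((1 + norm w) / 2)"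
      by (simp add: field_simps)
  qed
  also have "cball (0::complex) ((1 + norm w) / 2) \<subseteq> ball 0 1"
    using assms by auto
  finally show "cball w ?d \<subseteq> ball 0 1" .
  have "uniform_limit (cball 0 ((1 + norm w) / 2)) (\<lambda>N w. \<Prod>n<N. fac n w) bprod sequentially"
    using assms by (intro uniform_limit_partial_prod) (auto intro: add_pos_nonneg)
  then show "uniform_limit (cball w ?d) (\<lambda>N w. \<Prod>n<N. fac n w) bprod sequentially"
    by (rule uniform_limit_on_subset[OF _ sub])
qed

lemma bprod_holomorphic: "bprod holomorphic_on ball 0 1"
proof (rule holomorphic_uniform_sequence[OF open_ball])
  show "(\<lambda>w. \<Prod>n<N. fac n w) holomorphic_on ball 0 1" for N
    by (intro holomorphic_intros)
qed (rule locally_uniform_limit_partial_prod)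

text \<open>Omitting factors of modulus at most 1 can only increase the modulus of a
  product.\<close>

lemma norm_bprod_le_prod:
  assumes "finite F" "norm w < 1"
  shows "norm (bprod w) \<le> (\<Prod>n\<in>F. norm (fac n w))"
proof (rule Lim_bounded)
  show "(\<lambda>N. norm (\<Prod>n<N. fac n w)) \<longlonglongrightarrow> norm (bprod w)"
    by (intro tendsto_norm partial_prod_tendsto assms)
  \<comment> \<open>From this \<open>N\<close> on, the partial product contains every factor of
    \<open>F\<close>; inserting 0 covers empty \<open>F\<close>.\<close>
  show "\<forall>N\<ge>Suc (Max (insert 0 F)). norm (\<Prod>n<N. fac n w) \<le> (\<Prod>n\<in>F. norm (fac n w))"
  proof (intro allI impI)
    fix N assume N: "N \<ge> Suc (Max (insert 0 F))"
    have "F \<subseteq> {..<N}"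
    proof
      fix n assume "n \<in> F"
      then have "n \<le> Max (insert 0 F)" using assms by (intro Max_ge) auto
      then show "n \<in> {..<N}" using N by simp
    qed
    then show "norm (\<Prod>n<N. fac n w) \<le> (\<Prod>n\<in>F. norm (fac n w))"
      using prod.subset_diff[of F "{..<N}" "\<lambda>n. norm (fac n w)"] norm_fac_le_1[OF assms(2)]
      by (auto simp flip: prod_norm intro!: mult_left_le_one_le prod_nonneg prod_le_1)
  qed
qed

lemma norm_bprod_le_1: "norm w < 1 \<Longrightarrow> norm (bprod w) \<le> 1"
  using norm_bprod_le_prod[of "{}" w] by simp

lemma bprod_eq_0_iff:
  assumes "norm w < 1"
  shows "bprod w = 0 \<longleftrightarrow> w \<in> a ` I"
proof -
  have "fac n w = 0 \<longleftrightarrow> n \<in> I \<and> w = a n" for n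
    using blaschke_factor_eq_0_iff[OF zero_norm_less_1 assms] by (auto simp: fac_def)
  then have "0 \<in> range (\<lambda>n. fac n w) \<longleftrightarrow> w \<in> a ` I"
    by (auto simp: image_iff)
  then show ?thesis
    using has_prod_eq_0_iff[OF has_prod_fac[OF assms]] by simp
qed

lemma continuous_on_deriv_bprod: "continuous_on (ball 0 1) (deriv bprod)"
  by (intro holomorphic_on_imp_continuous_on holomorphic_deriv bprod_holomorphic) auto

text \<open>In the product rule all undifferentiated factors have modulus at most 1, so the
  derivative of a partial product is bounded by the sum of the moduli of the derivatives of its
  factors. The bound survives the limit because the derivatives converge too.\<close>

lemma norm_deriv_bprod_le:
  assumes "norm w < 1"
    and bound: "\<And>N. (\<Sum>n\<in>I \<inter> {..<N}. (1 - (norm (a n))\<^sup>2) / (norm (1 - cnj (a n) * w))\<^sup>2) \<le> C"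
  shows "norm (deriv bprod w) \<le> C"
proof -
  let ?P = "\<lambda>N w. \<Prod>n<N. fac n w"
  have hol: "?P N holomorphic_on ball 0 1" for N
    by (intro holomorphic_intros)
  have "\<exists>g'. \<forall>w\<in>ball 0 1. (bprod has_field_derivative g' w) (at w) \<and>
      (\<lambda>N. deriv (?P N) w) \<longlonglongrightarrow> g' w"
    by (rule has_complex_derivative_uniform_sequence[OF open_ball])
       (use hol locally_uniform_limit_partial_prod in
         \<open>blast intro: holomorphic_derivI[OF _ open_ball]\<close>)+
  then have lim: "(\<lambda>N. deriv (?P N) w) \<longlonglongrightarrow> deriv bprod w"
    using assms(1) DERIV_imp_deriv by fastforce
  have diff: "fac n field_differentiable at w" "?P N field_differentiable at w" for n N
    using assms(1) by (auto intro: holomorphic_on_imp_differentiable_at[OF _ open_ball] fac_holomorphic hol)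
  have "norm (deriv (?P N) w) \<le> (\<Sum>n<N. norm (deriv (fac n) w))" for N
  proof (induction N)
    case (Suc N)
    have "deriv (?P (Suc N)) w = ?P N w * deriv (fac N) w + deriv (?P N) w * fac N w"
      using diff by (simp add: deriv_mult)
    also have "norm \<dots> \<le> 1 * norm (deriv (fac N) w) + norm (deriv (?P N) w) * 1"
      unfolding norm_mult[symmetric]
      by (rule norm_triangle_mono; unfold norm_mult; rule mult_mono)
         (use norm_fac_le_1[OF assms(1)] in \<open>auto simp flip: prod_norm intro!: prod_le_1\<close>)
    finally show ?case using Suc by simp
  qed auto
  also have "(\<Sum>n<N. norm (deriv (fac n) w)) \<le> C" for N
  proof -
    have "norm (deriv (fac n) w) = (if n \<in> I then (1 - (norm (a n))\<^sup>2) / (norm (1 - cnj (a n) * w))\<^sup>2 else 0)"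
      for n
      using norm_deriv_blaschke_factor[OF zero_norm_less_1 assms(1)] by (simp add: fac_def[abs_def])
    then show ?thesis
      using bound[of N] by (simp add: sum.inter_restrict[symmetric] Int_commute)
  qed
  finally have "norm (deriv (?P N) w) \<le> C" for N .
  then show ?thesis
    using Lim_bounded[OF tendsto_norm[OF lim]] by blast
qed

text \<open>Cauchy's estimate on discs of radius \<open>x * (1 - norm w)\<close>, with
  \<open>x\<close> increasing to 1.\<close>

lemma norm_deriv_bprod_le_inverse:
  assumes "norm w < 1"
  shows "norm (deriv bprod w) \<le> 1 / (1 - norm w)"
proof (rule field_le_mult_one_interval)
  fix x :: real assume x: "0 < x" "x < 1"
  let ?r = "x * (1 - norm w)"
  have r: "0 < ?r" "?r < 1 - norm w"
    using x assms by (auto simp: mult_less_cancel_right2)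
  have sub: "cball w ?r \<subseteq> ball 0 1"
  proof
    fix z assume "z \<in> cball w ?r"
    then have "norm z \<le> norm w + ?r"
      using norm_triangle_sub[of z w] by (simp add: dist_norm norm_minus_commute)
    then show "z \<in> ball 0 1"
      using r by simp
  qed
  have "norm ((deriv ^^ 1) bprod w) \<le> fact 1 * 1 / ?r ^ 1"
  proof (rule Cauchy_inequality)
    show "bprod holomorphic_on ball w ?r" "continuous_on (cball w ?r) bprod"
      using sub ball_subset_cball bprod_holomorphic holomorphic_on_imp_continuous_on
      by (blast intro: holomorphic_on_subset)+
    show "norm (bprod z) \<le> 1" if "norm (w - z) = ?r" for z
      using that sub by (intro norm_bprod_le_1) (auto simp: subset_eq dist_norm)
  qed (use r in auto)
  then show "x * norm (deriv bprod w) \<le> 1 / (1 - norm w)"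
    using x assms by (simp add: field_simps)
qed

lemma subfamily: "J \<subseteq> I \<Longrightarrow> blaschke_zeros J a"
  using zero_norm_less_1 summable_on_subset_banach[OF summable_on_zeros]
  by unfold_locales auto

lemma finite_depth_ge:
  assumes "0 < e"
  shows "finite {n\<in>I. e \<le> 1 - norm (a n)}"
proof -
  have "eventually (\<lambda>n. depth n < e) sequentially"
    using summable_LIMSEQ_zero[OF summable_depth] assms by (rule order_tendstoD)
  then obtain N where N: "\<And>n. n \<ge> N \<Longrightarrow> depth n < e"
    by (auto simp: eventually_sequentially)
  have "{n\<in>I. e \<le> 1 - norm (a n)} \<subseteq> {..<N}"
  proof
    fix n assume "n \<in> {n\<in>I. e \<le> 1 - norm (a n)}"
    then have "\<not> depth n < e"
      by (simp add: depth_def)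
    then show "n \<in> {..<N}"
      using N[of n] by force
  qed
  then show ?thesis
    by (rule finite_subset) simp
qed

text \<open>The factors vanishing at \<open>z\<close> are finitely many and form a power; the
  product over the remaining indices is again a Blaschke product and does not vanish at
  \<open>z\<close>.\<close>

lemma zorder_bprod:
  assumes z: "norm z < 1" and B: "\<And>w. norm w < 1 \<Longrightarrow> B w = bprod w"
  shows "zorder B z = int (card {n\<in>I. a n = z})"
proof -
  define J where "J = {n\<in>I. a n \<noteq> z}"
  define m where "m = card {n\<in>I. a n = z}"
  \<comment> \<open>The cofactor of \<open>w - z\<close> in the Blaschke factor with zero
    \<open>z\<close>; it has no zero in the disc.\<close>
  define u where "u w = - (if z = 0 then 1 else cnj z / of_real (norm z)) / (1 - cnj z * w)" for w
  interpret J: blaschke_zeros J a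
    by (rule subfamily) (auto simp: J_def)
  have fin: "finite {n\<in>I. a n = z}"
    by (rule finite_subset[OF _ finite_depth_ge[of "1 - norm z"]]) (use z in auto)
  have "blaschke_factor z w = u w * (w - z)" for w
  proof -
    have "c * ((z - w) / q) = - c / q * (w - z)" for c q :: complex
      by (simp add: divide_inverse algebra_simps)
    then show ?thesis
      unfolding blaschke_factor_def u_def .
  qed
  moreover have "bprod w = blaschke_factor z w ^ m * J.bprod w" if "norm w < 1" for w
  proof -
    have "(\<lambda>n. if n \<in> {n\<in>I. a n = z} then blaschke_factor z w else 1) has_prod
        (\<Prod>n\<in>{n\<in>I. a n = z}. blaschke_factor z w)"
      by (rule has_prod_If_finite_set[OF fin])
    from has_prod_mult[OF this J.has_prod_fac[OF that]]
    have "(\<lambda>n. (if n \<in> {n\<in>I. a n = z} then blaschke_factor z w else 1) * J.fac n w)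
        has_prod (blaschke_factor z w ^ m * J.bprod w)"
      by (simp add: m_def)
    also have "(\<lambda>n. (if n \<in> {n\<in>I. a n = z} then blaschke_factor z w else 1) * J.fac n w) =
        (\<lambda>n. fac n w)"
      unfolding fac_def J.fac_def by (auto simp: fun_eq_iff J_def)
    finally have "(\<lambda>n. fac n w) has_prod (blaschke_factor z w ^ m * J.bprod w)" .
    then show ?thesis
      using has_prod_unique2 has_prod_fac[OF that] by blast
  qed
  ultimately have eq: "B w = (u w ^ m * J.bprod w) * (w - z) powi int m" if "norm w < 1" for w
    using that B by (simp add: power_mult_distrib)
  have "zorder B z = int m"
  proof (rule zorder_eqI)
    show "open (ball (0::complex) 1)" "z \<in> ball 0 1"
      using z by auto
    show "(\<lambda>w. u w ^ m * J.bprod w) holomorphic_on ball 0 1"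
      unfolding u_def
      by (intro holomorphic_intros J.bprod_holomorphic) (use norm_one_minus_ge(3) z in auto)
    show "u z ^ m * J.bprod z \<noteq> 0"
      using norm_one_minus_ge(3)[OF z z] J.bprod_eq_0_iff[OF z] by (auto simp: u_def J_def)
    show "B w = (u w ^ m * J.bprod w) * (w - z) powi int m" if "w \<in> ball 0 1" for w
      using that eq by simp
  qed
  then show ?thesis
    by (simp add: m_def)
qed

text \<open>Counting indices instead of points builds in multiplicity. Both ends are closed, as in
  \<open>dyadic_zeros\<close>, so a zero at distance \<open>1 / 2 ^ (k + 1)\<close> from the circle
  lies in two consecutive sets.\<close>

definition dyadic_index :: "nat \<Rightarrow> nat set" where
  "dyadic_index k = {n\<in>I. 1 / 2 ^ (k + 1) \<le> 1 - norm (a n) \<and> 1 - norm (a n) \<le> 1 / 2 ^ k}"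

lemma finite_dyadic_index: "finite (dyadic_index k)"
  by (rule finite_subset[OF _ finite_depth_ge[of "1 / 2 ^ (k + 1)"]]) (auto simp: dyadic_index_def)

lemma sum_zorder_dyadic_zeros:
  assumes B: "\<And>w. norm w < 1 \<Longrightarrow> B w = bprod w"
  shows "finite (dyadic_zeros B k)"
    and "(\<Sum>z\<in>dyadic_zeros B k. of_int (zorder B z)) = real (card (dyadic_index k))"
proof -
  have img: "dyadic_zeros B k = a ` dyadic_index k"
    using zero_norm_less_1 B bprod_eq_0_iff
    by (auto simp: dyadic_zeros_def dyadic_index_def)
  then show "finite (dyadic_zeros B k)"
    by (simp add: finite_dyadic_index)
  have "(\<Sum>z\<in>dyadic_zeros B k. of_int (zorder B z)) =
      (\<Sum>z\<in>a ` dyadic_index k. \<Sum>n\<in>{n\<in>dyadic_index k. a n = z}. 1 :: real)"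
    unfolding img
  proof (rule sum.cong[OF refl])
    fix z assume z: "z \<in> a ` dyadic_index k"
    then have "norm z < 1"
      using zero_norm_less_1 by (auto simp: dyadic_index_def)
    moreover have "{n\<in>dyadic_index k. a n = z} = {n\<in>I. a n = z}"
      using z by (auto simp: dyadic_index_def)
    ultimately show "of_int (zorder B z) = (\<Sum>n\<in>{n\<in>dyadic_index k. a n = z}. 1 :: real)"
      using zorder_bprod[OF _ B] by simp
  qed
  also have "\<dots> = (\<Sum>n\<in>dyadic_index k. 1)"
    by (rule sum.image_gen[OF finite_dyadic_index, symmetric])
  finally show "(\<Sum>z\<in>dyadic_zeros B k. of_int (zorder B z)) = real (card (dyadic_index k))"
    by simp
qed

end

lemma blaschke_product_imp_zeros:
  assumes "blaschke_product B"
  obtains I a where "blaschke_zeros I a" "\<And>w. norm w < 1 \<Longrightarrow> B w = blaschke_zeros.bprod I a w"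
proof -
  from assms obtain I :: "nat set" and a :: "nat \<Rightarrow> complex" where
    *: "\<forall>n\<in>I. a n \<in> ball 0 1" "(\<lambda>n. 1 - norm (a n)) summable_on I"
      "\<forall>w\<in>ball 0 1. (\<lambda>n. if n \<in> I then blaschke_factor (a n) w else 1) has_prod B w"
    unfolding blaschke_product_def by blast
  interpret blaschke_zeros I a
    by unfold_locales (use * in auto)
  have "B w = bprod w" if "norm w < 1" for w
    using *(3) that by (simp add: bprod_def fac_def has_prod_unique)
  then show thesis
    using that blaschke_zeros_axioms by blast
qed

section \<open>Superlevel sets on circles, in the angular parameter\<close>

definition circle_set :: "(complex \<Rightarrow> complex) \<Rightarrow> real \<Rightarrow> real \<Rightarrow> real set" where
  "circle_set f r l = {t \<in> {0..<2 * pi}. l < norm (f (of_real r * cis t))}"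

lemma circle_length_eq:
  "circle_length {u \<in> sphere 0 1. norm (f (of_real r * u)) > l} = measure lebesgue (circle_set f r l)"
  unfolding circle_length_def circle_set_def by (rule arg_cong[where f = "measure lebesgue"]) auto

lemma continuous_on_circle:
  fixes g :: "complex \<Rightarrow> 'a :: topological_space"
  assumes "continuous_on (ball 0 1) g" "0 \<le> r" "r < 1"
  shows "continuous_on A (\<lambda>t. g (of_real r * cis t))"
  by (rule continuous_on_compose2[OF assms(1)])
     (use assms in \<open>auto intro!: continuous_intros simp: norm_mult\<close>)

lemma circle_compose_measurable:
  fixes g :: "complex \<Rightarrow> 'a :: {real_normed_vector}"
  assumes "continuous_on (ball 0 1) g" "0 \<le> r" "r < 1"
  shows "(\<lambda>t. g (of_real r * cis t)) \<in> borel_measurable borel"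
  by (intro borel_measurable_continuous_onI continuous_on_circle assms)

lemma circle_set_borel:
  assumes "continuous_on (ball 0 1) f" "0 \<le> r" "r < 1"
  shows "circle_set f r l \<in> sets borel"
proof -
  have [measurable]: "(\<lambda>t. f (of_real r * cis t)) \<in> borel_measurable borel"
    by (rule circle_compose_measurable) fact+
  show ?thesis
    unfolding circle_set_def by measurable
qed

text \<open>The weak type condition uses the real-valued Lebesgue measure, the integrals below use
  \<open>emeasure lborel\<close>. On Borel subsets of one period everything is finite, so the two
  can be exchanged.\<close>

lemma measure_subset_period:
  assumes "S \<in> sets borel" "S \<subseteq> {0..<2 * pi}"
  shows "emeasure lborel S = ennreal (measure lebesgue S)" "measure lborel S = measure lebesgue S"
    "measure lebesgue S \<le> 2 * pi"
proof -
  have 1: "measure lborel S = measure lebesgue S"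
    using assms by (simp add: measure_completion)
  have "emeasure lborel S \<le> emeasure lborel {0..<2*pi}"
    using assms by (intro emeasure_mono) auto
  also have "\<dots> = ennreal (2 * pi)"
    by (simp add: ennreal_mult)
  finally have "emeasure lborel S \<le> ennreal (2 * pi)" .
  then have "emeasure lborel S \<noteq> \<infinity>"
    using infinity_ennreal_def neq_top_trans ennreal_neq_top by metis
  then show 2: "emeasure lborel S = ennreal (measure lebesgue S)"
    unfolding 1[symmetric] by (intro emeasure_eq_ennreal_measure) auto
  show "measure lborel S = measure lebesgue S" by fact
  show "measure lebesgue S \<le> 2 * pi"
    using \<open>emeasure lborel S \<le> ennreal (2 * pi)\<close> unfolding 2 by simp
qed

section \<open>From bounded dyadic counts to the weak type estimate\<close>

lemma norm_cis_diff: "norm (cis t - cis s) = 2 * \<bar>sin ((t - s) / 2)\<bar>"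
proof -
  have "cos (t - s) = 1 - 2 * (sin ((t - s) / 2))\<^sup>2"
    using cos_double_sin[of "(t - s) / 2"] by (simp only: times_divide_eq_right nonzero_mult_div_cancel_left)
  moreover have "(norm (cis t - cis s))\<^sup>2 = 2 - 2 * cos (t - s)"
    unfolding cmod_power2 using sin_cos_squared_add[of t] sin_cos_squared_add[of s]
    by (simp add: power2_diff cos_diff algebra_simps)
  ultimately have "(norm (cis t - cis s))\<^sup>2 = (2 * \<bar>sin ((t - s) / 2)\<bar>)\<^sup>2"
    by (simp add: power_mult_distrib)
  then show ?thesis
    by (rule power2_eq_imp_eq) auto
qed

text \<open>By concavity, the sine lies above its chord from 0 to \<open>pi / 2\<close>.\<close>

lemma jordan_sin_ge:
  fixes x :: real
  assumes "0 \<le> x" "x \<le> pi / 2"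
  shows "2 * x / pi \<le> sin x"
proof -
  have "convex_on {0..pi / 2} (\<lambda>x. - sin x)"
  proof (rule convex_on_realI[where f' = "\<lambda>x. - cos x"])
    show "- cos x \<le> - cos y" if "x \<in> {0..pi / 2}" "y \<in> {0..pi / 2}" "x \<le> y" for x y
      using that by (auto intro!: cos_monotone_0_pi_le)
  qed (auto intro!: derivative_eq_intros)
  then have "- sin ((1 - 2 * x / pi) *\<^sub>R 0 + (2 * x / pi) *\<^sub>R (pi / 2))
      \<le> (1 - 2 * x / pi) * (- sin 0) + (2 * x / pi) * (- sin (pi / 2))"
    by (rule convex_onD) (use assms in \<open>auto simp: field_simps\<close>)
  then show ?thesis
    by simp
qed

text \<open>A short chord means that the angles are close modulo \<open>2 * pi\<close>; the last two
  alternatives are the wrap-around at the ends of the period.\<close>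

lemma norm_cis_diff_less_imp:
  assumes "t \<in> {0..<2 * pi}" "s \<in> {0..<2 * pi}" "norm (cis t - cis s) < e"
  shows "\<bar>t - s\<bar> < pi * e / 2 \<or> \<bar>t - (s - 2 * pi)\<bar> < pi * e / 2 \<or> \<bar>t - (s + 2 * pi)\<bar> < pi * e / 2"
proof -
  define x where "x = \<bar>t - s\<bar> / 2"
  have x: "0 \<le> x" "x < pi"
    using assms by (auto simp: x_def abs_if)
  have "2 * sin x < e"
  proof -
    have "\<bar>sin ((t - s) / 2)\<bar> = \<bar>sin x\<bar>"
      unfolding x_def abs_if[of "t - s"] by (auto simp: minus_divide_left[symmetric] simp del: minus_diff_eq)
    moreover have "0 \<le> sin x"
      using x by (intro sin_ge_zero) auto
    ultimately show ?thesis
      using assms(3) unfolding norm_cis_diff by simp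
  qed
  \<comment> \<open>Beyond \<open>pi / 2\<close> the bound is applied to the reflected angle
    \<open>pi - x\<close>.\<close>
  moreover have "2 * x / pi \<le> sin x \<or> 2 * (pi - x) / pi \<le> sin x"
    using jordan_sin_ge[of x] jordan_sin_ge[of "pi - x"] x by (cases "x \<le> pi / 2") auto
  ultimately have "2 * (2 * x / pi) < e \<or> 2 * (2 * (pi - x) / pi) < e"
    by linarith
  then have "2 * x < pi * e / 2 \<or> 2 * (pi - x) < pi * e / 2"
    by (auto simp: field_simps)
  moreover define c where "c = pi * e / 2"
  ultimately have "\<bar>t - s\<bar> < c \<or> 2 * pi - \<bar>t - s\<bar> < c"
    by (auto simp: x_def)
  moreover have "\<bar>t - s\<bar> < 2 * pi"
    using assms(1,2) by auto
  ultimately have "\<bar>t - s\<bar> < c \<or> \<bar>t - (s - 2 * pi)\<bar> < c \<or> \<bar>t - (s + 2 * pi)\<bar> < c"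
    by arith
  then show ?thesis
    by (simp add: c_def)
qed

text \<open>Each of the three alternatives above contributes an interval of length
  \<open>pi * e\<close>.\<close>

lemma emeasure_arc_le:
  assumes "s \<in> {0..<2 * pi}" "0 < e"
  shows "{t \<in> {0..<2 * pi}. norm (cis t - cis s) < e} \<in> sets borel"
    and "emeasure lborel {t \<in> {0..<2 * pi}. norm (cis t - cis s) < e} \<le> ennreal (3 * pi * e)"
proof -
  have [measurable]: "cis \<in> borel_measurable borel"
    by (intro borel_measurable_continuous_onI continuous_intros)
  show "{t \<in> {0..<2 * pi}. norm (cis t - cis s) < e} \<in> sets borel"
    by measurable
  let ?J = "\<lambda>c. {c - pi * e / 2<..<c + pi * e / 2}"
  have "{t \<in> {0..<2 * pi}. norm (cis t - cis s) < e} \<subseteq> ?J s \<union> ?J (s - 2 * pi) \<union> ?J (s + 2 * pi)"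
  proof
    fix t assume "t \<in> {t \<in> {0..<2 * pi}. norm (cis t - cis s) < e}"
    then have "\<bar>t - s\<bar> < pi * e / 2 \<or> \<bar>t - (s - 2 * pi)\<bar> < pi * e / 2 \<or>
        \<bar>t - (s + 2 * pi)\<bar> < pi * e / 2"
      using norm_cis_diff_less_imp[OF _ assms(1)] by blast
    then show "t \<in> ?J s \<union> ?J (s - 2 * pi) \<union> ?J (s + 2 * pi)"
      unfolding Un_iff greaterThanLessThan_iff by linarith
  qed
  then have "emeasure lborel {t \<in> {0..<2 * pi}. norm (cis t - cis s) < e}
      \<le> emeasure lborel (?J s \<union> ?J (s - 2 * pi) \<union> ?J (s + 2 * pi))"
    by (intro emeasure_mono) auto
  also have "\<dots> \<le> emeasure lborel (?J s \<union> ?J (s - 2 * pi)) + emeasure lborel (?J (s + 2 * pi))"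
    by (intro emeasure_subadditive) auto
  also have "\<dots> \<le> (emeasure lborel (?J s) + emeasure lborel (?J (s - 2 * pi))) + emeasure lborel (?J (s + 2 * pi))"
    by (intro add_right_mono emeasure_subadditive) auto
  also have "\<dots> = ennreal (3 * pi * e)"
  proof -
    have "emeasure lborel (?J c) = ennreal (pi * e)" for c
      using assms by (subst emeasure_lborel_Ioo) (auto simp: mult_pos_pos)
    then show ?thesis
      using assms by (simp add: ennreal_plus[symmetric] del: ennreal_plus)
  qed
  finally show "emeasure lborel {t \<in> {0..<2 * pi}. norm (cis t - cis s) < e} \<le> ennreal (3 * pi * e)" .
qed

text \<open>After a rotation the claim concerns \<open>1 - cis (t - s)\<close> and
  \<open>1 - q * cis (t - s)\<close> with \<open>q = norm a * r\<close>. These differ by at most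
  \<open>1 - q\<close>, which is itself at most the modulus of the second. It bounds the
  denominators of the derivative below by the angular distance from the zero.\<close>

lemma norm_cis_Arg_diff_le:
  assumes "norm a < 1" "0 < r" "r < 1"
  shows "norm (cis t - cis (Arg2pi a)) \<le> 2 * norm (1 - cnj a * (of_real r * cis t))"
proof -
  define s where "s = Arg2pi a"
  define q where "q = norm a * r"
  have q: "0 \<le> q" "q < 1"
    using assms mult_strict_mono[of "norm a" 1 r 1] by (auto simp: q_def)
  have a: "a = of_real (norm a) * cis s"
    using Arg2pi_eq[of a] by (simp add: s_def cis_conv_exp mult.commute)
  have "cnj a * (of_real r * cis t) = of_real q * cis (t - s)"
    by (subst a) (simp add: q_def cis_cnj cis_mult algebra_simps)
  moreover have "norm (cis t - cis s) = norm (1 - cis (t - s))"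
  proof -
    have "cis t - cis s = - cis s * (1 - cis (t - s))"
      by (simp add: algebra_simps cis_mult)
    then show ?thesis
      by (simp add: norm_mult)
  qed
  moreover have "norm (1 - cis (t - s)) \<le> norm (1 - of_real q * cis (t - s)) + (1 - q)"
  proof -
    have "1 - cis (t - s) = (1 - of_real q * cis (t - s)) + (- of_real (1 - q) * cis (t - s))"
      by (simp add: algebra_simps)
    also have "norm \<dots> \<le> norm (1 - of_real q * cis (t - s)) + norm (- of_real (1 - q) * cis (t - s))"
      by (rule norm_triangle_ineq)
    also have "norm (- complex_of_real (1 - q) * cis (t - s)) = 1 - q"
      using q by (simp add: norm_mult del: of_real_diff)
    finally show ?thesis .
  qed
  moreover have "1 - q \<le> norm (1 - of_real q * cis (t - s))"
    using norm_triangle_ineq2[of 1 "of_real q * cis (t - s)"] q by (simp add: norm_mult)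
  ultimately show ?thesis
    unfolding s_def[symmetric] by simp
qed

section \<open>Sums over dyadic scales\<close>

text \<open>Sorting by the value of \<open>c\<close> leaves at most \<open>M\<close> terms per
  value. Applied to the scales of zeros, this is how the bound on the counts enters.\<close>

lemma sum_fibers_le:
  fixes h :: "nat \<Rightarrow> real"
  assumes "finite F" "\<And>k. real (card {n\<in>F. c n = k}) \<le> M" "\<And>k. 0 \<le> h k"
    and S: "\<And>N. (\<Sum>k<N. h k) \<le> S"
  shows "(\<Sum>n\<in>F. h (c n)) \<le> M * S"
proof -
  obtain N where N: "c ` F \<subseteq> {..<N}"
    using finite_nat_bounded[of "c ` F"] assms(1) by auto
  have M: "0 \<le> M"
    using assms(2)[of 0] by (meson of_nat_0_le_iff order_trans)
  have "(\<Sum>n\<in>F. h (c n)) = (\<Sum>k\<in>c ` F. \<Sum>n\<in>{n\<in>F. c n = k}. h (c n))"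
    by (rule sum.image_gen[OF assms(1)])
  also have "\<dots> = (\<Sum>k\<in>c ` F. real (card {n\<in>F. c n = k}) * h k)"
    by (intro sum.cong) auto
  also have "\<dots> \<le> (\<Sum>k\<in>c ` F. M * h k)"
    by (intro sum_mono mult_right_mono assms)
  also have "\<dots> = M * (\<Sum>k\<in>c ` F. h k)"
    by (simp add: sum_distrib_left)
  also have "(\<Sum>k\<in>c ` F. h k) \<le> (\<Sum>k<N. h k)"
    using N assms by (intro sum_mono2) auto
  also note S
  finally show ?thesis
    using M by (simp add: mult_left_mono)
qed

lemma sum_geometric_above_le:
  fixes q :: real
  assumes "0 \<le> q" "q < 1"
  shows "(\<Sum>k<N. if K < k then q ^ (k - K) else 0) \<le> q / (1 - q)"
proof -
  let ?f = "\<lambda>k. if K < k then q ^ (k - K) else 0"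
  have "(\<Sum>k<K + 1 + j. ?f k) = (q - q ^ (j + 1)) / (1 - q)" for j
  proof (induction j)
    case 0
    then show ?case by (auto intro!: sum.neutral)
  next
    case (Suc j)
    have "(\<Sum>k<K + 1 + Suc j. ?f k) = (q - q ^ (j + 1)) / (1 - q) + q ^ (j + 1)"
      using Suc by simp
    also have "\<dots> = (q - q ^ (Suc j + 1)) / (1 - q)"
      using assms by (simp add: field_simps)
    finally show ?case .
  qed
  note eq = this
  \<comment> \<open>The terms are nonnegative, so the range may be enlarged to one covered by the
    closed form.\<close>
  have "(\<Sum>k<N. ?f k) \<le> (\<Sum>k<K + 1 + N. ?f k)"
    using assms by (intro sum_mono2) auto
  also have "\<dots> \<le> q / (1 - q)"
    unfolding eq using assms by (intro divide_right_mono) auto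
  finally show ?thesis .
qed

lemma sum_power2_below_le:
  "(\<Sum>k<N. if k \<le> K then 2 ^ k else (0::real)) \<le> 2 * 2 ^ K"
proof -
  have "(\<Sum>k<N. if k \<le> K then 2 ^ k else (0::real)) \<le> (\<Sum>k<Suc K + N. if k \<le> K then 2 ^ k else 0)"
    by (intro sum_mono2) auto
  also have "\<dots> = (\<Sum>k<Suc K. 2 ^ k)"
    by (rule sum.mono_neutral_cong_right) auto
  also have "\<dots> = 2 ^ Suc K - 1"
    using geometric_sum[of "2::real" "Suc K"] by simp
  finally show ?thesis by simp
qed

section \<open>Exceptional arcs and the derivative away from them\<close>

context blaschke_zeros
begin

text \<open>For \<open>n\<close> in \<open>I\<close> this is the \<open>k\<close> with
  \<open>1 / 2 ^ (k + 1) < depth n \<le> 1 / 2 ^ k\<close>. The half-open range gives each zero a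
  single scale, although the sets \<open>dyadic_index k\<close> overlap.\<close>

definition scale :: "nat \<Rightarrow> nat" where
  "scale n = (LEAST k. 1 / 2 ^ (k + 1) < depth n)"

lemma scale_bounds:
  assumes "n \<in> I"
  shows "1 / 2 ^ (scale n + 1) < depth n" "depth n \<le> 1 / 2 ^ scale n"
proof -
  obtain k where "(1 / 2) ^ k < depth n"
    using real_arch_pow_inv[OF depth_pos[OF assms], of "1 / 2"] by auto
  moreover have "(1 / 2 :: real) ^ (k + 1) \<le> (1 / 2) ^ k"
    by (intro power_decreasing) auto
  ultimately have "1 / 2 ^ (k + 1) < depth n"
    by (simp add: power_one_over)
  then show "1 / 2 ^ (scale n + 1) < depth n"
    unfolding scale_def by (rule LeastI)
  show "depth n \<le> 1 / 2 ^ scale n"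
  proof (cases "scale n")
    case 0
    then show ?thesis using depth_bounds by simp
  next
    case (Suc j)
    then have "\<not> 1 / 2 ^ (j + 1) < depth n"
      using not_less_Least[of j "\<lambda>k. 1 / 2 ^ (k + 1) < depth n"] by (simp add: scale_def)
    then show ?thesis using Suc by simp
  qed
qed

lemma scale_imp_dyadic_index: "n \<in> I \<Longrightarrow> n \<in> dyadic_index (scale n)"
  using scale_bounds[of n] by (auto simp: dyadic_index_def depth_def)

lemma sum_scale_le:
  fixes h :: "nat \<Rightarrow> real"
  assumes "\<And>k. real (card (dyadic_index k)) \<le> M" "finite F" "F \<subseteq> I"
    "\<And>k. 0 \<le> h k" "\<And>N. (\<Sum>k<N. h k) \<le> S"
  shows "(\<Sum>n\<in>F. h (scale n)) \<le> M * S"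
proof (rule sum_fibers_le)
  show "real (card {n\<in>F. scale n = k}) \<le> M" for k
  proof -
    have "{n\<in>F. scale n = k} \<subseteq> dyadic_index k"
      using scale_imp_dyadic_index assms by auto
    then have "card {n\<in>F. scale n = k} \<le> card (dyadic_index k)"
      by (intro card_mono finite_dyadic_index)
    with assms(1)[of k] show ?thesis
      by linarith
  qed
qed (use assms in auto)

text \<open>The ratio 3/4 lies between \<open>1 / sqrt 2\<close> and 1: below 1, so that the widths
  are summable over the scales, and with square above 1/2, so that \<open>depth\<close> divided by
  the squared width is summable too.\<close>

definition arc_width :: "nat \<Rightarrow> nat \<Rightarrow> real" where
  "arc_width K k = (1 / 2 ^ K) * (3 / 4) ^ (k - K)"

definition exceptional :: "nat \<Rightarrow> nat \<Rightarrow> real set" where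
  "exceptional K n = (if n \<in> I \<and> K < scale n
     then {t \<in> {0..<2 * pi}. norm (cis t - cis (Arg2pi (a n))) < 2 * arc_width K (scale n)} else {})"

lemma arc_width_pos: "0 < arc_width K k"
  by (simp add: arc_width_def)

lemma Arg2pi_mem: "Arg2pi z \<in> {0..<2 * pi}"
  using Arg2pi[of z] by auto

lemma exceptional_borel: "exceptional K n \<in> sets borel"
proof -
  have "{t \<in> {0..<2 * pi}. norm (cis t - cis (Arg2pi (a n))) < 2 * arc_width K (scale n)} \<in> sets borel"
    by (rule emeasure_arc_le(1)[OF Arg2pi_mem]) (simp add: arc_width_pos)
  then show ?thesis
    unfolding exceptional_def by (metis (no_types, lifting) sets.empty_sets)
qed

text \<open>An arc at scale \<open>k\<close> has length at most
  \<open>3 * pi * (2 * arc_width K k)\<close>, and the powers of 3/4 with positive exponent sum to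
  3; hence the constant 18.\<close>

lemma emeasure_exceptional_le:
  assumes M: "\<And>k. real (card (dyadic_index k)) \<le> M"
  shows "emeasure lborel (\<Union>n. exceptional K n) \<le> ennreal (18 * pi * M / 2 ^ K)"
proof -
  define h where "h k = (if K < k then 6 * pi * arc_width K k else 0)" for k
  have h: "0 \<le> h k" for k
    by (simp add: h_def arc_width_def)
  have "(\<Sum>k<N. h k) = 6 * pi / 2 ^ K * (\<Sum>k<N. if K < k then (3 / 4) ^ (k - K) else 0)" for N
    unfolding sum_distrib_left by (intro sum.cong) (auto simp: h_def arc_width_def)
  moreover have "(\<Sum>k<N. if K < k then (3 / 4) ^ (k - K) else 0) \<le> (3 :: real)" for N
    using sum_geometric_above_le[of "3 / 4" K N] by simp
  ultimately have S: "(\<Sum>k<N. h k) \<le> 6 * pi / 2 ^ K * 3" for N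
    by (metis (no_types, lifting) mult_left_mono divide_nonneg_pos mult_nonneg_nonneg pi_ge_zero
        zero_le_numeral zero_less_numeral zero_less_power)
  have le: "emeasure lborel (exceptional K n) \<le> ennreal (if n \<in> I then h (scale n) else 0)" for n
  proof (cases "n \<in> I \<and> K < scale n")
    case True
    have "emeasure lborel (exceptional K n) \<le> ennreal (3 * pi * (2 * arc_width K (scale n)))"
      unfolding exceptional_def if_P[OF True]
      by (rule emeasure_arc_le(2)[OF Arg2pi_mem]) (simp add: arc_width_pos)
    moreover have "(if n \<in> I then h (scale n) else 0) = 3 * pi * (2 * arc_width K (scale n))"
      using True by (simp add: h_def)
    ultimately show ?thesis
      by simp
  next
    case False
    then have "exceptional K n = {}"
      by (simp only: exceptional_def if_False)
    then show ?thesis by simp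
  qed
  have "emeasure lborel (\<Union>n. exceptional K n) \<le> (\<Sum>n. emeasure lborel (exceptional K n))"
    using exceptional_borel by (intro emeasure_subadditive_countably) auto
  also have "\<dots> = (SUP N. \<Sum>n<N. emeasure lborel (exceptional K n))"
    by (rule suminf_eq_SUP)
  also have "\<dots> \<le> ennreal (18 * pi * M / 2 ^ K)"
  proof (rule SUP_least)
    fix N
    have "(\<Sum>n<N. emeasure lborel (exceptional K n)) \<le> (\<Sum>n<N. ennreal (if n \<in> I then h (scale n) else 0))"
      by (intro sum_mono le)
    also have "\<dots> = ennreal (\<Sum>n<N. if n \<in> I then h (scale n) else 0)"
      using h by (intro sum_ennreal) auto
    also have "(\<Sum>n<N. if n \<in> I then h (scale n) else 0) = (\<Sum>n\<in>{..<N} \<inter> I. h (scale n))"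
      by (simp add: sum.inter_restrict)
    also have "\<dots> \<le> M * (6 * pi / 2 ^ K * 3)"
      using M h S by (intro sum_scale_le) auto
    finally show "(\<Sum>n<N. emeasure lborel (exceptional K n)) \<le> ennreal (18 * pi * M / 2 ^ K)"
      by (simp add: ac_simps ennreal_leI)
  qed
  finally show ?thesis .
qed

lemma norm_deriv_bprod_le_off_exceptional:
  assumes M: "\<And>k. real (card (dyadic_index k)) \<le> M"
    and r: "0 < r" "r < 1" and t: "t \<in> {0..<2 * pi}" "t \<notin> (\<Union>n. exceptional K n)"
  shows "norm (deriv bprod (of_real r * cis t)) \<le> 24 * M * 2 ^ K"
proof (rule norm_deriv_bprod_le)
  let ?w = "of_real r * cis t"
  show w: "norm ?w < 1"
    using r by (simp add: norm_mult)
  \<comment> \<open>The two parts majorise a zero of scale at most \<open>K\<close>, through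
    \<open>2 / depth n\<close>, and a zero of larger scale outside its arc. Their sums are at most
    \<open>8 * 2 ^ K\<close> and \<open>16 * 2 ^ K\<close>.\<close>
  define h where "h k = 4 * (if k \<le> K then 2 ^ k else 0)
      + 2 * 2 ^ K * (if K < k then (8 / 9) ^ (k - K) else (0::real))" for k
  have h: "0 \<le> h k" for k
    by (simp add: h_def)
  have S: "(\<Sum>k<N. h k) \<le> 24 * 2 ^ K" for N
  proof -
    have "(\<Sum>k<N. if K < k then (8 / 9) ^ (k - K) else 0) \<le> (8 :: real)"
      using sum_geometric_above_le[of "8 / 9" K N] by simp
    then have "2 * 2 ^ K * (\<Sum>k<N. if K < k then (8 / 9) ^ (k - K) else 0) \<le> 2 * 2 ^ K * (8 :: real)"
      by (intro mult_left_mono) auto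
    moreover note sum_power2_below_le[of K N]
    ultimately show ?thesis
      unfolding h_def sum.distrib sum_distrib_left[symmetric] by linarith
  qed
  have term_le: "(1 - (norm (a n))\<^sup>2) / (norm (1 - cnj (a n) * ?w))\<^sup>2 \<le> h (scale n)" if n: "n \<in> I" for n
  proof -
    let ?q = "norm (1 - cnj (a n) * ?w)"
    have an: "norm (a n) < 1"
      by (rule zero_norm_less_1[OF n])
    have d: "depth n = 1 - norm (a n)"
      using n by (simp add: depth_def)
    have num: "1 - (norm (a n))\<^sup>2 \<le> 2 * depth n"
    proof -
      have "1 - (norm (a n))\<^sup>2 = (1 + norm (a n)) * depth n"
        by (simp add: d power2_eq_square algebra_simps)
      also have "\<dots> \<le> 2 * depth n"
        using an depth_bounds by (intro mult_right_mono) auto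
      finally show ?thesis .
    qed
    have bound: "(1 - (norm (a n))\<^sup>2) / ?q\<^sup>2 \<le> 2 * depth n / e\<^sup>2" if "0 < e" "e \<le> ?q" for e
      using num that depth_bounds[of n] by (intro frac_le power_mono) auto
    show ?thesis
    proof (cases "scale n \<le> K")
      case True
      have "(1 - (norm (a n))\<^sup>2) / ?q\<^sup>2 \<le> 2 * depth n / (depth n)\<^sup>2"
        using depth_pos[OF n] norm_one_minus_ge(2)[OF an w] by (intro bound) (auto simp: d)
      also have "\<dots> = 2 / depth n"
        by (simp add: power2_eq_square)
      also have "\<dots> \<le> 2 / (1 / 2 ^ (scale n + 1))"
        using scale_bounds[OF n] by (intro divide_left_mono mult_pos_pos) (auto simp: depth_pos[OF n])
      also have "\<dots> = h (scale n)"
        using True by (simp add: h_def)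
      finally show ?thesis .
    next
      case False
      define j where "j = scale n - K"
      have sj: "scale n = K + j"
        using False by (simp add: j_def)
      let ?e = "arc_width K (scale n)"
      have "t \<notin> exceptional K n"
        using t by blast
      then have "2 * ?e \<le> norm (cis t - cis (Arg2pi (a n)))"
        using False n t(1) by (auto simp: exceptional_def)
      also have "\<dots> \<le> 2 * ?q"
        by (rule norm_cis_Arg_diff_le[OF an r])
      finally have "(1 - (norm (a n))\<^sup>2) / ?q\<^sup>2 \<le> 2 * depth n / ?e\<^sup>2"
        by (intro bound) (auto simp: arc_width_def)
      also have "\<dots> \<le> 2 * (1 / 2 ^ scale n) / ?e\<^sup>2"
        using scale_bounds(2)[OF n] by (intro divide_right_mono mult_left_mono) auto
      also have "\<dots> = 2 * 2 ^ K * (8 / 9) ^ j"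
      proof -
        \<comment> \<open>Each further scale halves the depth and multiplies the squared width by
          9/16, so the quotient gains the factor 8/9.\<close>
        have "(9 / 16 :: real) ^ j = ((3 / 4) ^ j)\<^sup>2"
          by (simp add: power2_eq_square flip: power_mult_distrib)
        moreover have "(1 / 2 :: real) ^ j = (8 / 9) ^ j * (9 / 16) ^ j"
          by (simp flip: power_mult_distrib)
        ultimately show ?thesis
          by (simp add: arc_width_def sj power_add power2_eq_square field_simps power_one_over)
      qed
      also have "\<dots> = h (scale n)"
        using False by (simp add: h_def j_def)
      finally show ?thesis .
    qed
  qed
  show "(\<Sum>n\<in>I \<inter> {..<N}. (1 - (norm (a n))\<^sup>2) / (norm (1 - cnj (a n) * ?w))\<^sup>2) \<le> 24 * M * 2 ^ K"
    for N
  proof -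
    have "(\<Sum>n\<in>I \<inter> {..<N}. (1 - (norm (a n))\<^sup>2) / (norm (1 - cnj (a n) * ?w))\<^sup>2)
        \<le> (\<Sum>n\<in>I \<inter> {..<N}. h (scale n))"
      by (intro sum_mono term_le) auto
    also have "\<dots> \<le> M * (24 * 2 ^ K)"
      using M h S by (intro sum_scale_le) auto
    finally show ?thesis by simp
  qed
qed

text \<open>For small \<open>l\<close> the full length \<open>2 * pi\<close> suffices. Otherwise
  \<open>K\<close> is chosen so that the bound off the exceptional arcs is at most \<open>l\<close>;
  the superlevel set then lies inside these arcs.\<close>

lemma weak_type_of_dyadic_bound:
  assumes M: "0 < M" "\<And>k. real (card (dyadic_index k)) \<le> M"
    and r: "0 < r" "r < 1" and l: "0 < l"
  shows "measure lebesgue (circle_set (deriv bprod) r l) \<le> (48 * pi * M + 864 * pi * M\<^sup>2) / l"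
proof -
  have meas: "circle_set (deriv bprod) r l \<in> sets borel" for l
    using r by (intro circle_set_borel continuous_on_deriv_bprod) auto
  have sub: "circle_set (deriv bprod) r l \<subseteq> {0..<2 * pi}" for l
    by (auto simp: circle_set_def)
  show ?thesis
  proof (cases "l < 24 * M")
    case True
    have "measure lebesgue (circle_set (deriv bprod) r l) \<le> 2 * pi"
      by (rule measure_subset_period(3)[OF meas sub])
    also have "\<dots> \<le> 48 * pi * M / l"
      using True l by (simp add: field_simps)
    also have "\<dots> \<le> (48 * pi * M + 864 * pi * M\<^sup>2) / l"
      using l M by (intro divide_right_mono) auto
    finally show ?thesis .
  next
    case False
    \<comment> \<open>The largest \<open>K\<close> with \<open>24 * M * 2 ^ K \<le> l\<close>;
      maximality gives \<open>1 / 2 ^ K \<le> 48 * M / l\<close>.\<close>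
    define K where "K = nat \<lfloor>log 2 (l / (24 * M))\<rfloor>"
    have 1: "1 \<le> l / (24 * M)"
      using False M by (simp add: field_simps)
    then have "0 \<le> log 2 (l / (24 * M))"
      by simp
    then have "real K \<le> log 2 (l / (24 * M))" "log 2 (l / (24 * M)) < real K + 1"
      unfolding K_def by linarith+
    then have K: "2 ^ K \<le> l / (24 * M)" "l / (24 * M) < 2 ^ (K + 1)"
      using 1 by (simp_all add: le_log_iff log_less_iff powr_realpow powr_add)
    have Kl: "24 * M * 2 ^ K \<le> l"
      using K(1) M by (simp add: field_simps)
    have "circle_set (deriv bprod) r l \<subseteq> (\<Union>n. exceptional K n)"
    proof
      fix t assume t: "t \<in> circle_set (deriv bprod) r l"
      show "t \<in> (\<Union>n. exceptional K n)"
      proof (rule ccontr)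
        assume "t \<notin> (\<Union>n. exceptional K n)"
        then have "norm (deriv bprod (of_real r * cis t)) \<le> 24 * M * 2 ^ K"
          using t r by (intro norm_deriv_bprod_le_off_exceptional M) (auto simp: circle_set_def)
        then show False
          using t Kl by (auto simp: circle_set_def)
      qed
    qed
    moreover have "(\<Union>n. exceptional K n) \<in> sets lborel"
      using exceptional_borel by auto
    ultimately have "emeasure lborel (circle_set (deriv bprod) r l) \<le> emeasure lborel (\<Union>n. exceptional K n)"
      by (intro emeasure_mono)
    also note emeasure_exceptional_le[OF M(2)]
    finally have "measure lebesgue (circle_set (deriv bprod) r l) \<le> 18 * pi * M / 2 ^ K"
      using M(1) unfolding measure_subset_period(1)[OF meas sub] by simp
    also have "\<dots> \<le> 18 * pi * M * (48 * M / l)"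
    proof -
      have "1 / 2 ^ K \<le> 48 * M / l"
        using K(2) M l by (simp add: field_simps)
      then have "18 * pi * M * (1 / 2 ^ K) \<le> 18 * pi * M * (48 * M / l)"
        using M by (intro mult_left_mono) auto
      then show ?thesis by simp
    qed
    also have "\<dots> = 864 * pi * M\<^sup>2 / l"
      by (simp add: power2_eq_square)
    also have "\<dots> \<le> (48 * pi * M + 864 * pi * M\<^sup>2) / l"
      using l M by (intro divide_right_mono) auto
    finally show ?thesis .
  qed
qed

end

section \<open>From the weak type estimate to bounded dyadic counts\<close>

text \<open>Cauchy's formula at the centre, followed by the triangle inequality for
  integrals.\<close>

lemma norm_at_0_le_circle_mean:
  assumes hol: "g holomorphic_on ball 0 1" and r: "0 < r" "r < 1"
  shows "2 * pi * norm (g 0) \<le> integral {0..2 * pi} (\<lambda>t. norm (g (of_real r * cis t)))"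
proof -
  have "((\<lambda>u. g u / (u - 0)) has_contour_integral 2 * of_real pi * \<i> * g 0) (circlepath 0 r)"
    by (rule Cauchy_integral_circlepath_simple) (use r in \<open>auto intro!: holomorphic_on_subset[OF hol]\<close>)
  then have "((\<lambda>t. g (of_real r * cis t) * \<i>) has_integral 2 * of_real pi * \<i> * g 0) {0..2 * pi}"
    unfolding circlepath_def has_contour_integral_part_circlepath_iff[of 0 "2 * pi", simplified]
    by (rule has_integral_eq[rotated]) (use r in \<open>auto simp: field_simps\<close>)
  then have "norm (2 * of_real pi * \<i> * g 0) = norm (integral {0..2 * pi} (\<lambda>t. g (of_real r * cis t) * \<i>))"
    by (simp only: integral_unique)
  also have "\<dots> \<le> integral {0..2 * pi} (\<lambda>t. norm (g (of_real r * cis t)))"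
    by (rule integral_norm_bound_integral)
       (use r holomorphic_on_imp_continuous_on[OF hol] in
         \<open>auto intro!: integrable_continuous_real continuous_intros continuous_on_circle simp: norm_mult\<close>)
  finally show ?thesis
    by (simp add: norm_mult)
qed

lemma circle_defect_le:
  assumes hol: "g holomorphic_on ball 0 1" and r: "0 < r" "r < 1"
    and le1: "\<And>w. norm w < 1 \<Longrightarrow> norm (g w) \<le> 1"
  shows "(\<integral>\<^sup>+t. ennreal (1 - norm (g (of_real r * cis t))) * indicator {0..2 * pi} t \<partial>lborel)
           \<le> ennreal (2 * pi * (1 - norm (g 0)))"
proof -
  let ?g = "\<lambda>t. norm (g (of_real r * cis t))"
  have int: "?g integrable_on {0..2 * pi}"
    by (intro integrable_continuous_real continuous_intros continuous_on_circle holomorphic_on_imp_continuous_on hol)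
       (use r in auto)
  have "((\<lambda>t. 1 - ?g t) has_integral 2 * pi - integral {0..2 * pi} ?g) {0..2 * pi}"
    using has_integral_diff[OF has_integral_const_real[of "1::real" 0 "2 * pi"] integrable_integral[OF int]]
    by simp
  then have "(\<integral>\<^sup>+t. ennreal (1 - ?g t) * indicator {0..2 * pi} t \<partial>lborel)
      = ennreal (2 * pi - integral {0..2 * pi} ?g)"
    by (rule nn_integral_has_integral_lebesgue'[rotated]) (use le1 r in \<open>auto simp: norm_mult\<close>)
  also have "\<dots> \<le> ennreal (2 * pi * (1 - norm (g 0)))"
    using norm_at_0_le_circle_mean[OF hol r] by (intro ennreal_leI) (simp add: algebra_simps)
  finally show ?thesis .
qed

text \<open>The induction step is \<open>1 - x * y \<le> (1 - x) + (1 - y)\<close>, that is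
  \<open>(1 - x) * (1 - y) \<ge> 0\<close>.\<close>

lemma one_minus_prod_le_sum:
  fixes f :: "'a \<Rightarrow> real"
  assumes "finite A" "\<And>x. x \<in> A \<Longrightarrow> 0 \<le> f x \<and> f x \<le> 1"
  shows "1 - prod f A \<le> (\<Sum>x\<in>A. 1 - f x)"
  using assms
proof (induction A)
  case (insert x A)
  have "0 \<le> prod f A" "prod f A \<le> 1"
    using insert by (auto intro!: prod_nonneg prod_le_1)
  then have "1 - f x * prod f A \<le> (1 - f x) + (1 - prod f A)"
    using mult_nonneg_nonneg[of "1 - f x" "1 - prod f A"] insert by (simp add: algebra_simps)
  then show ?case
    using insert by simp
qed auto

context blaschke_zeros
begin

lemma one_minus_norm_bprod_le:
  assumes "norm w < 1"
  shows "ennreal (1 - norm (bprod w)) \<le> (\<Sum>n. ennreal (1 - norm (fac n w)))"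
proof -
  have "(\<lambda>N. ennreal (1 - norm (\<Prod>n<N. fac n w))) \<longlonglongrightarrow> ennreal (1 - norm (bprod w))"
    by (intro tendsto_ennrealI tendsto_intros partial_prod_tendsto assms)
  then show ?thesis
  proof (rule LIMSEQ_le_const2, intro exI allI impI)
    fix N :: nat
    have "ennreal (1 - norm (\<Prod>n<N. fac n w)) \<le> ennreal (\<Sum>n<N. 1 - norm (fac n w))"
      using norm_fac_le_1[OF assms]
      by (intro ennreal_leI) (auto simp flip: prod_norm intro!: one_minus_prod_le_sum)
    also have "\<dots> = (\<Sum>n<N. ennreal (1 - norm (fac n w)))"
      using norm_fac_le_1[OF assms] by (intro sum_ennreal[symmetric]) auto
    also have "\<dots> \<le> (\<Sum>n. ennreal (1 - norm (fac n w)))"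
      by (rule sum_le_suminf) auto
    finally show "ennreal (1 - norm (\<Prod>n<N. fac n w)) \<le> (\<Sum>n. ennreal (1 - norm (fac n w)))" .
  qed
qed

text \<open>The first bound, from the mean value inequality, is summable in \<open>n\<close>
  uniformly in \<open>r\<close>; the second tends to 0 as \<open>r\<close> tends to 1 for fixed
  \<open>n\<close>. Together they permit dominated convergence of the series.\<close>

lemma circle_defect_fac_le:
  assumes r: "0 < r" "r < 1"
  shows "(\<integral>\<^sup>+t. ennreal (1 - norm (fac n (of_real r * cis t))) * indicator {0..2 * pi} t \<partial>lborel)
     \<le> ennreal (2 * pi * min (depth n) ((1 - r\<^sup>2) / (depth n)\<^sup>2))" (is "?L \<le> _")
proof (cases "n \<in> I")
  \<comment> \<open>Here \<open>depth n\<close> is 0 and division by zero gives 0, so both sides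
    vanish.\<close>
  case False
  then show ?thesis by (simp add: fac_def)
next
  case True
  have an: "norm (a n) < 1"
    by (rule zero_norm_less_1[OF True])
  have "?L \<le> ennreal (2 * pi * (1 - norm (fac n 0)))"
    by (intro circle_defect_le fac_holomorphic r norm_fac_le_1)
  moreover have "1 - norm (fac n 0) = depth n"
    using True by (simp add: fac_def depth_def norm_blaschke_factor_0)
  moreover have "?L \<le> ennreal (2 * pi * ((1 - r\<^sup>2) / (depth n)\<^sup>2))"
  proof -
    have *: "1 - norm (fac n (of_real r * cis t)) \<le> (1 - r\<^sup>2) / (depth n)\<^sup>2" for t
    proof -
      let ?w = "of_real r * cis t"
      have w: "norm ?w < 1" "norm ?w = r"
        using r by (auto simp: norm_mult)
      have "(norm (fac n ?w))\<^sup>2 \<le> norm (fac n ?w)"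
        using norm_fac_le_1[OF w(1)] by (simp add: power2_eq_square mult_left_le_one_le)
      then have "1 - norm (fac n ?w) \<le> 1 - (norm (blaschke_factor (a n) ?w))\<^sup>2"
        using True by (simp add: fac_def)
      also have "\<dots> = (1 - (norm (a n))\<^sup>2) * (1 - r\<^sup>2) / (norm (1 - cnj (a n) * ?w))\<^sup>2"
        using one_minus_norm_blaschke_factor_sq[OF an w(1)] w(2) by simp
      also have "\<dots> \<le> 1 * (1 - r\<^sup>2) / (depth n)\<^sup>2"
        using r depth_pos[OF True] norm_one_minus_ge(2)[OF an w(1)] True
        by (intro frac_le mult_mono power_mono) (auto simp: depth_def power_le_one)
      finally show ?thesis by simp
    qed
    have "?L \<le> (\<integral>\<^sup>+t. ennreal ((1 - r\<^sup>2) / (depth n)\<^sup>2) * indicator {0..2 * pi} t \<partial>lborel)"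
      by (intro nn_integral_mono mult_right_mono ennreal_leI *) auto
    also have "\<dots> = ennreal ((1 - r\<^sup>2) / (depth n)\<^sup>2) * ennreal (2 * pi)"
      by (simp add: nn_integral_cmult_indicator)
    also have "\<dots> = ennreal (2 * pi * ((1 - r\<^sup>2) / (depth n)\<^sup>2))"
      using r by (subst ennreal_mult'[symmetric]) (auto simp: mult.commute power_le_one intro!: divide_nonneg_nonneg)
    finally show ?thesis .
  qed
  ultimately show ?thesis
    by (auto simp: min_def)
qed

text \<open>The radial limits of a Blaschke product are unimodular almost everywhere; only this
  integrated form is needed.\<close>

lemma circle_defect_bprod_small:
  assumes "\<rho> < 1" "0 < e"
  shows "\<exists>r. 0 < r \<and> \<rho> < r \<and> r < 1 \<and>
    (\<integral>\<^sup>+t. ennreal (1 - norm (bprod (of_real r * cis t))) * indicator {0..2 * pi} t \<partial>lborel) \<le> ennreal e"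
proof -
  define b where "b n r = 2 * pi * min (depth n) ((1 - r\<^sup>2) / (depth n)\<^sup>2)" for n r
  have lim: "((\<lambda>r. b n r) \<longlongrightarrow> 0) (at_left 1)" for n
  proof -
    have "((\<lambda>r. b n r) \<longlongrightarrow> 2 * pi * min (depth n) ((1 - 1\<^sup>2) / (depth n)\<^sup>2)) (at_left 1)"
    proof (cases "depth n = 0")
      case False
      then show ?thesis
        unfolding b_def by (intro tendsto_intros) auto
    qed (simp add: b_def)
    then show ?thesis
      using depth_bounds(1)[of n] by simp
  qed
  have nonneg: "0 \<le> b n r" if "0 < r" "r < 1" for n r
    using that depth_bounds(1)[of n] by (auto simp: b_def power_le_one intro!: divide_nonneg_nonneg)
  have bound: "norm (b n r) \<le> 2 * pi * depth n" if "0 < r" "r < 1" for n r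
    using nonneg[OF that, of n] unfolding real_norm_def by (simp add: b_def)
  have ev01: "eventually (\<lambda>r::real. max 0 \<rho> < r \<and> r < 1) (at_left 1)"
    using eventually_at_left_field[of "\<lambda>r. max 0 \<rho> < r \<and> r < 1" 1] assms(1)
    by (auto intro!: exI[of _ "max 0 \<rho>"])
  \<comment> \<open>Tannery's theorem with the summable majorant
    \<open>2 * pi * depth n\<close>.\<close>
  have "((\<lambda>r. \<Sum>n. b n r) \<longlongrightarrow> (\<Sum>n::nat. 0)) (at_left 1)"
  proof (rule tannerys_theorem[THEN conjunct2, THEN conjunct2])
    show "eventually (\<lambda>(n, r). norm (b n r) \<le> 2 * pi * depth n) (at_top \<times>\<^sub>F at_left 1)"
      using eventually_prodI[OF always_eventually ev01, of "\<lambda>_. True" at_top]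
      by (rule eventually_mono) (use bound in auto)
  qed (auto intro!: lim summable_mult summable_depth)
  then have "eventually (\<lambda>r. (\<Sum>n. b n r) < e) (at_left 1)"
    using assms(2) by (intro order_tendstoD) auto
  then have "eventually (\<lambda>r. (\<Sum>n. b n r) < e \<and> max 0 \<rho> < r \<and> r < 1) (at_left 1)"
    using ev01 by (rule eventually_conj)
  then obtain r where r: "(\<Sum>n. b n r) < e" "0 < r" "\<rho> < r" "r < 1"
    using eventually_happens by force
  have [measurable]: "(\<lambda>t. norm (fac n (of_real r * cis t))) \<in> borel_measurable borel" for n
    using r by (intro borel_measurable_continuous_onI continuous_intros continuous_on_circle
        holomorphic_on_imp_continuous_on fac_holomorphic) auto
  have "(\<integral>\<^sup>+t. ennreal (1 - norm (bprod (of_real r * cis t))) * indicator {0..2 * pi} t \<partial>lborel)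
      \<le> (\<integral>\<^sup>+t. (\<Sum>n. ennreal (1 - norm (fac n (of_real r * cis t))) * indicator {0..2 * pi} t) \<partial>lborel)"
    unfolding ennreal_suminf_multc
    using r by (intro nn_integral_mono mult_right_mono one_minus_norm_bprod_le) (auto simp: norm_mult)
  also have "\<dots> = (\<Sum>n. \<integral>\<^sup>+t. ennreal (1 - norm (fac n (of_real r * cis t))) * indicator {0..2 * pi} t \<partial>lborel)"
    by (rule nn_integral_suminf) measurable
  also have "\<dots> \<le> (\<Sum>n. ennreal (b n r))"
    unfolding b_def by (intro suminf_le circle_defect_fac_le r) auto
  also have "\<dots> = ennreal (\<Sum>n. b n r)"
  proof (rule suminf_ennreal2)
    show "summable (\<lambda>n. b n r)"
      by (rule summable_comparison_test'[of "\<lambda>n. 2 * pi * depth n"])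
         (use bound r in \<open>auto intro!: summable_mult summable_depth\<close>)
  qed (use nonneg r in auto)
  also have "\<dots> \<le> ennreal e"
    using r by (intro ennreal_leI) auto
  finally show ?thesis
    using r by blast
qed

end

section \<open>Integrating the weak type inequality over a region above a set of angles\<close>

text \<open>Layer cake: on \<open>S\<close>, \<open>f\<close> is at most \<open>\<mu>\<close> plus
  the length of the levels in \<open>{\<mu>..L}\<close> below \<open>f\<close>. Fubini turns the
  second part into the integral of \<open>C / l\<close> over these levels, whence the
  logarithm.\<close>

lemma nn_integral_le_of_weak_type:
  fixes f :: "real \<Rightarrow> real"
  assumes [measurable]: "f \<in> borel_measurable borel" "S \<in> sets borel"
    and S: "emeasure lborel S = ennreal m" "0 \<le> m"
    and L: "0 < \<mu>" "\<mu> \<le> L" "\<And>t. t \<in> S \<Longrightarrow> f t \<le> L"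
    and weak: "\<And>l. 0 < l \<Longrightarrow> emeasure lborel {t\<in>S. l < f t} \<le> ennreal (C / l)" "0 \<le> C"
  shows "(\<integral>\<^sup>+t. ennreal (f t) * indicator S t \<partial>lborel) \<le> ennreal (\<mu> * m + C * ln (L / \<mu>))"
proof -
  have "(\<integral>\<^sup>+t. ennreal (f t) * indicator S t \<partial>lborel) \<le>
      (\<integral>\<^sup>+t. ennreal \<mu> * indicator S t +
        (\<integral>\<^sup>+l. indicator {\<mu>..L} l * indicator {t\<in>S. l < f t} t \<partial>lborel) \<partial>lborel)"
  proof (rule nn_integral_mono)
    fix t
    show "ennreal (f t) * indicator S t \<le> ennreal \<mu> * indicator S t +
        (\<integral>\<^sup>+l. indicator {\<mu>..L} l * indicator {t\<in>S. l < f t} t \<partial>lborel)"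
    proof (cases "t \<in> S \<and> \<mu> < f t")
      case True
      have "ennreal (f t) = ennreal \<mu> + ennreal (f t - \<mu>)"
        using True L by (subst ennreal_plus[symmetric]) auto
      also have "ennreal (f t - \<mu>) = emeasure lborel {\<mu>..<f t}"
        using True by simp
      also have "\<dots> = (\<integral>\<^sup>+l. indicator {\<mu>..<f t} l \<partial>lborel)"
        by simp
      also have "\<dots> \<le> (\<integral>\<^sup>+l. indicator {\<mu>..L} l * indicator {t\<in>S. l < f t} t \<partial>lborel)"
        using True L(3)[of t] by (intro nn_integral_mono) (auto simp: indicator_def)
      finally show ?thesis
        using True by (simp add: add_left_mono)
    next
      case False
      then have "ennreal (f t) * indicator S t \<le> ennreal \<mu> * indicator S t"
        by (auto simp: indicator_def intro!: ennreal_leI)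
      then show ?thesis
        by (simp add: add_increasing2)
    qed
  qed
  also have "\<dots> = (\<integral>\<^sup>+t. ennreal \<mu> * indicator S t \<partial>lborel) +
      (\<integral>\<^sup>+t. (\<integral>\<^sup>+l. indicator {\<mu>..L} l * indicator {t\<in>S. l < f t} t \<partial>lborel) \<partial>lborel)"
    by (rule nn_integral_add) measurable
  also have "(\<integral>\<^sup>+t. (\<integral>\<^sup>+l. indicator {\<mu>..L} l * indicator {t\<in>S. l < f t} t \<partial>lborel) \<partial>lborel) =
      (\<integral>\<^sup>+l. (\<integral>\<^sup>+t. indicator {\<mu>..L} l * indicator {t\<in>S. l < f t} t \<partial>lborel) \<partial>lborel)"
    by (rule lborel_pair.Fubini') measurable
  also have "\<dots> \<le> (\<integral>\<^sup>+l. ennreal (C / l) * indicator {\<mu>..L} l \<partial>lborel)"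
  proof (rule nn_integral_mono)
    fix l :: real
    have "(\<integral>\<^sup>+t. indicator {\<mu>..L} l * indicator {t\<in>S. l < f t} t \<partial>lborel)
        = indicator {\<mu>..L} l * emeasure lborel {t\<in>S. l < f t}"
      by (subst nn_integral_cmult) auto
    also have "\<dots> \<le> ennreal (C / l) * indicator {\<mu>..L} l"
      using weak(1)[of l] L(1) by (auto simp: indicator_def)
    finally show "(\<integral>\<^sup>+t. indicator {\<mu>..L} l * indicator {t\<in>S. l < f t} t \<partial>lborel)
        \<le> ennreal (C / l) * indicator {\<mu>..L} l" .
  qed
  also have "\<dots> = ennreal (C * ln (L / \<mu>))"
  proof (rule nn_integral_has_integral_lebesgue')
    have "((\<lambda>l. C / l) has_integral (C * ln L - C * ln \<mu>)) {\<mu>..L}"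
      by (rule fundamental_theorem_of_calculus[OF L(2)])
         (use L in \<open>auto intro!: derivative_eq_intros simp flip: has_real_derivative_iff_has_vector_derivative\<close>)
    then show "((\<lambda>l. C / l) has_integral C * ln (L / \<mu>)) {\<mu>..L}"
      using L by (simp add: ln_div right_diff_distrib)
  qed (use L weak in auto)
  also have "(\<integral>\<^sup>+t. ennreal \<mu> * indicator S t \<partial>lborel) = ennreal (\<mu> * m)"
    using S L by (simp add: nn_integral_cmult_indicator ennreal_mult)
  also have "ennreal (\<mu> * m) + ennreal (C * ln (L / \<mu>)) = ennreal (\<mu> * m + C * ln (L / \<mu>))"
    using L S weak by (intro ennreal_plus[symmetric] mult_nonneg_nonneg) auto
  finally show ?thesis
    by (simp add: add_right_mono add_left_mono)
qed

text \<open>Clamping the radius to the interval keeps the integrand continuous for all real radii.\<close>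

lemma measurable_radial:
  fixes f :: "complex \<Rightarrow> complex"
  assumes "continuous_on (ball 0 1) f" "0 \<le> \<rho>" "\<rho> \<le> r" "r < 1"
  shows "(\<lambda>(t, s). norm (f (of_real (max \<rho> (min r s)) * cis t))) \<in> borel_measurable (lborel \<Otimes>\<^sub>M lborel)"
proof -
  have "continuous_on UNIV (\<lambda>x :: real \<times> real. norm (f (of_real (max \<rho> (min r (snd x))) * cis (fst x))))"
    by (intro continuous_on_norm continuous_on_compose2[OF assms(1)])
       (use assms in \<open>auto intro!: continuous_intros simp: norm_mult\<close>)
  then have "(\<lambda>x :: real \<times> real. norm (f (of_real (max \<rho> (min r (snd x))) * cis (fst x)))) \<in> borel_measurable borel"
    by (rule borel_measurable_continuous_onI)
  then show ?thesis
    by (simp add: split_beta' lborel_prod)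
qed

text \<open>The fundamental theorem of calculus along the radius at angle \<open>t\<close>.\<close>

lemma radial_increment_le:
  assumes hol: "g holomorphic_on ball 0 1" and r: "0 \<le> \<rho>" "\<rho> \<le> r" "r < 1"
  shows "ennreal (norm (g (of_real r * cis t) - g (of_real \<rho> * cis t)))
    \<le> (\<integral>\<^sup>+s. ennreal (norm (deriv g (of_real s * cis t))) * indicator {\<rho>..r} s \<partial>lborel)"
proof -
  let ?d = "\<lambda>s. deriv g (of_real s * cis t)"
  have cont: "continuous_on {\<rho>..r} ?d"
    by (rule continuous_on_compose2[OF holomorphic_on_imp_continuous_on[OF holomorphic_deriv[OF hol open_ball]]])
       (use r in \<open>auto intro!: continuous_intros simp: norm_mult\<close>)
  have "((\<lambda>s. ?d s * cis t) has_integral g (of_real r * cis t) - g (of_real \<rho> * cis t)) {\<rho>..r}"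
  proof (rule fundamental_theorem_of_calculus[OF r(2)])
    fix s assume s: "s \<in> {\<rho>..r}"
    have "((\<lambda>z. g (z * cis t)) has_field_derivative ?d s * cis t) (at (of_real s))"
      by (rule DERIV_chain2[OF holomorphic_derivI[OF hol open_ball]])
         (use s r in \<open>auto intro!: derivative_eq_intros simp: norm_mult\<close>)
    then show "((\<lambda>s. g (of_real s * cis t)) has_vector_derivative ?d s * cis t) (at s within {\<rho>..r})"
      using has_vector_derivative_real_field has_vector_derivative_at_within by blast
  qed
  then have "norm (g (of_real r * cis t) - g (of_real \<rho> * cis t)) = norm (integral {\<rho>..r} (\<lambda>s. ?d s * cis t))"
    by (simp only: integral_unique)
  also have "\<dots> \<le> integral {\<rho>..r} (\<lambda>s. norm (?d s))"
    by (rule integral_norm_bound_integral)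
       (use cont in \<open>auto intro!: integrable_continuous_real continuous_intros simp: norm_mult\<close>)
  also have "ennreal (integral {\<rho>..r} (\<lambda>s. norm (?d s))) =
      (\<integral>\<^sup>+s. ennreal (norm (?d s)) * indicator {\<rho>..r} s \<partial>lborel)"
    by (rule nn_integral_has_integral_lebesgue'[symmetric])
       (use cont in \<open>auto intro!: integrable_integral integrable_continuous_real continuous_intros\<close>)
  finally show ?thesis
    by (simp add: ennreal_leI)
qed

text \<open>The bound does not depend on \<open>r\<close>, which may therefore be chosen arbitrarily
  close to 1 afterwards.\<close>

lemma nn_integral_log_weight:
  assumes r: "0 \<le> \<rho>" "\<rho> \<le> r" "r < 1" and \<mu>: "0 < \<mu>" "\<mu> * (1 - \<rho>) \<le> 1" and A: "0 \<le> A" "0 \<le> C"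
  shows "(\<integral>\<^sup>+s. ennreal (A + C * ln (1 / (\<mu> * (1 - s)))) * indicator {\<rho>..r} s \<partial>lborel)
    \<le> ennreal ((1 - \<rho>) * (A + C * (1 - ln (\<mu> * (1 - \<rho>)))))"
proof -
  have mu_le: "0 < \<mu> * (1 - s)" "\<mu> * (1 - s) \<le> 1" if "\<rho> \<le> s" "s \<le> r" for s
  proof -
    show "0 < \<mu> * (1 - s)" using that r \<mu> by simp
    have "\<mu> * (1 - s) \<le> \<mu> * (1 - \<rho>)" using that \<mu> by simp
    then show "\<mu> * (1 - s) \<le> 1" using \<mu> by linarith
  qed
  \<comment> \<open>An antiderivative of the integrand; its logarithmic term at the upper end
    \<open>r\<close> is nonpositive and is dropped below.\<close>
  define G where "G s = A * s + C * ((1 - s) * (ln (\<mu> * (1 - s)) - 1))" for s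
  have "((\<lambda>s. A + C * ln (1 / (\<mu> * (1 - s)))) has_integral G r - G \<rho>) {\<rho>..r}"
  proof (rule fundamental_theorem_of_calculus[OF r(2)])
    fix s assume s: "s \<in> {\<rho>..r}"
    then have pos: "0 < \<mu> * (1 - s)" "0 < 1 - s"
      using mu_le r by auto
    have "(G has_real_derivative
        A + C * (- (ln (\<mu> * (1 - s)) - 1) + (1 - s) * (\<mu> * (-1) / (\<mu> * (1 - s))))) (at s)"
      unfolding G_def using pos by (auto intro!: derivative_eq_intros)
    moreover have "(1 - s) * (\<mu> * (-1) / (\<mu> * (1 - s))) = -1"
      using \<mu> pos by simp
    moreover have "ln (1 / (\<mu> * (1 - s))) = - ln (\<mu> * (1 - s))"
      using ln_div[of 1 "\<mu> * (1 - s)"] pos by simp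
    ultimately have "(G has_real_derivative A + C * ln (1 / (\<mu> * (1 - s)))) (at s)"
      by (simp only:) simp
    then show "(G has_vector_derivative A + C * ln (1 / (\<mu> * (1 - s)))) (at s within {\<rho>..r})"
      using has_real_derivative_iff_has_vector_derivative has_vector_derivative_at_within by blast
  qed
  then have "(\<integral>\<^sup>+s. ennreal (A + C * ln (1 / (\<mu> * (1 - s)))) * indicator {\<rho>..r} s \<partial>lborel) = ennreal (G r - G \<rho>)"
  proof (rule nn_integral_has_integral_lebesgue'[rotated])
    fix s assume "s \<in> {\<rho>..r}"
    then have "0 \<le> ln (1 / (\<mu> * (1 - s)))"
      using mu_le[of s] by (intro ln_ge_zero) (auto simp: field_simps)
    then show "0 \<le> A + C * ln (1 / (\<mu> * (1 - s)))"
      using A by simp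
  qed
  also have "\<dots> \<le> ennreal ((1 - \<rho>) * (A + C * (1 - ln (\<mu> * (1 - \<rho>)))))"
  proof (rule ennreal_leI)
    have "C * ((1 - r) * (ln (\<mu> * (1 - r)) - 1)) \<le> 0"
    proof -
      have "ln (\<mu> * (1 - r)) \<le> 0"
        using mu_le[of r] r by simp
      then show ?thesis
        using r A by (intro mult_nonneg_nonpos mult_nonneg_nonneg) auto
    qed
    moreover have "A * r \<le> A * 1"
      using A r by (intro mult_left_mono) auto
    ultimately show "G r - G \<rho> \<le> (1 - \<rho>) * (A + C * (1 - ln (\<mu> * (1 - \<rho>))))"
      by (simp add: G_def algebra_simps)
  qed
  finally show ?thesis .
qed

context blaschke_zeros
begin

text \<open>The pointwise bound \<open>1 / (1 - s)\<close> on the derivative makes the layer cake integral of the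
  weak type estimate grow only like \<open>ln (1 / (1 - s))\<close>, which is integrable in \<open>s\<close>.\<close>

lemma measure_le_of_weak_type:
  assumes weak: "\<And>r l. 0 < r \<Longrightarrow> r < 1 \<Longrightarrow> 0 < l \<Longrightarrow> measure lebesgue (circle_set (deriv bprod) r l) \<le> C / l"
    and C: "0 \<le> C" and c: "0 < c" "c \<le> 1" and d: "0 < d" "d < 1"
    and S: "S \<in> sets borel" "S \<subseteq> {0..<2 * pi}"
    and le: "\<And>t. t \<in> S \<Longrightarrow> norm (bprod (of_real (1 - d) * cis t)) \<le> 1 - c"
  shows "measure lebesgue S \<le> 2 * C / c * (1 + ln (2 / c)) * d"
proof -
  define m where "m = measure lebesgue S"
  \<comment> \<open>Integrating the level \<open>\<mu>\<close> over the region of radial width at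
    most \<open>d\<close> above \<open>S\<close> costs at most \<open>c / 2 * m\<close>, half of the
    left-hand side, which is absorbed at the end.\<close>
  define \<mu> where "\<mu> = c / (2 * d)"
  have m: "emeasure lborel S = ennreal m" "0 \<le> m"
    using measure_subset_period(1)[OF S] by (auto simp: m_def)
  have \<mu>: "0 < \<mu>" "\<mu> * d = c / 2"
    using c d by (auto simp: \<mu>_def)
  have "c * m \<le> c / 2 * m + C * (1 + ln (2 / c)) * d"
  \<comment> \<open>The error \<open>e\<close> is the mean defect of the product from modulus 1 on a
    circle of radius \<open>r\<close> close to 1.\<close>
  proof (rule field_le_epsilon)
    fix e :: real assume e: "0 < e"
    obtain r where r: "0 < r" "1 - d < r" "r < 1" and
      small: "(\<integral>\<^sup>+t. ennreal (1 - norm (bprod (of_real r * cis t))) * indicator {0..2 * pi} t \<partial>lborel) \<le> ennreal e"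
      using circle_defect_bprod_small[of "1 - d" e] d e by auto
    note [measurable] = S(1)
    let ?B = "\<lambda>r t. bprod (of_real r * cis t)"
    let ?f = "\<lambda>t s. norm (deriv bprod (of_real (max (1 - d) (min r s)) * cis t))"
    have [measurable]: "(\<lambda>t. ?B r t) \<in> borel_measurable borel" "(\<lambda>t. ?B (1 - d) t) \<in> borel_measurable borel"
      by (intro circle_compose_measurable holomorphic_on_imp_continuous_on bprod_holomorphic; use r d in simp)+
    note cont = continuous_on_deriv_bprod
    have f_meas: "(\<lambda>(t, s). ?f t s) \<in> borel_measurable (lborel \<Otimes>\<^sub>M lborel)"
      by (rule measurable_radial[OF cont]) (use r d in auto)
    have "ennreal (c * m) = (\<integral>\<^sup>+t. ennreal c * indicator S t \<partial>lborel)"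
      using m c by (simp add: nn_integral_cmult_indicator ennreal_mult)
    also have "\<dots> \<le> (\<integral>\<^sup>+t. ennreal (1 - norm (?B r t)) * indicator S t
        + ennreal (norm (?B r t - ?B (1 - d) t)) * indicator S t \<partial>lborel)"
    proof (rule nn_integral_mono)
      fix t
      show "ennreal c * indicator S t \<le> ennreal (1 - norm (?B r t)) * indicator S t
        + ennreal (norm (?B r t - ?B (1 - d) t)) * indicator S t"
      proof (cases "t \<in> S")
        case True
        have "norm (?B r t) \<le> 1"
          using r by (intro norm_bprod_le_1) (auto simp: norm_mult)
        \<comment> \<open>A deficit of \<open>c\<close> at radius \<open>1 - d\<close> either
          persists at radius \<open>r\<close> or is made up by radial growth.\<close>
        moreover have "c \<le> (1 - norm (?B r t)) + norm (?B r t - ?B (1 - d) t)"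
          using le[OF True] norm_triangle_ineq2[of "?B r t" "?B (1 - d) t"] by linarith
        ultimately show ?thesis
          using True by (simp add: ennreal_leI flip: ennreal_plus)
      qed simp
    qed
    also have "\<dots> = (\<integral>\<^sup>+t. ennreal (1 - norm (?B r t)) * indicator S t \<partial>lborel)
        + (\<integral>\<^sup>+t. ennreal (norm (?B r t - ?B (1 - d) t)) * indicator S t \<partial>lborel)"
      by (rule nn_integral_add) measurable
    also have "(\<integral>\<^sup>+t. ennreal (1 - norm (?B r t)) * indicator S t \<partial>lborel) \<le> ennreal e"
    proof (rule order_trans[OF nn_integral_mono small])
      show "ennreal (1 - norm (?B r t)) * indicator S t \<le> ennreal (1 - norm (?B r t)) * indicator {0..2 * pi} t" for t
        using S by (auto simp: indicator_def)
    qed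
    also have "(\<integral>\<^sup>+t. ennreal (norm (?B r t - ?B (1 - d) t)) * indicator S t \<partial>lborel)
        \<le> (\<integral>\<^sup>+t. (\<integral>\<^sup>+s. ennreal (?f t s) * indicator {1 - d..r} s * indicator S t \<partial>lborel) \<partial>lborel)"
    proof (rule nn_integral_mono)
      fix t
      have "ennreal (norm (?B r t - ?B (1 - d) t))
          \<le> (\<integral>\<^sup>+s. ennreal (norm (deriv bprod (of_real s * cis t))) * indicator {1 - d..r} s \<partial>lborel)"
        using r d by (intro radial_increment_le bprod_holomorphic) auto
      also have "\<dots> = (\<integral>\<^sup>+s. ennreal (?f t s) * indicator {1 - d..r} s \<partial>lborel)"
        by (intro nn_integral_cong) (auto simp: indicator_def max_absorb2 min_absorb2)
      finally show "ennreal (norm (?B r t - ?B (1 - d) t)) * indicator S t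
          \<le> (\<integral>\<^sup>+s. ennreal (?f t s) * indicator {1 - d..r} s * indicator S t \<partial>lborel)"
        by (auto simp: indicator_def)
    qed
    also have "\<dots> = (\<integral>\<^sup>+s. (\<integral>\<^sup>+t. ennreal (?f t s) * indicator {1 - d..r} s * indicator S t \<partial>lborel) \<partial>lborel)"
    proof (rule lborel_pair.Fubini')
      have "(\<lambda>(s, t). ?f t s) \<in> borel_measurable (lborel \<Otimes>\<^sub>M lborel)"
        using measurable_pair_swap[OF f_meas] by simp
      then show "(\<lambda>(s, t). ennreal (?f t s) * indicator {1 - d..r} s * indicator S t) \<in> borel_measurable (lborel \<Otimes>\<^sub>M lborel)"
        by measurable
    qed
    also have "\<dots> \<le> (\<integral>\<^sup>+s. ennreal (\<mu> * m + C * ln (1 / (\<mu> * (1 - s)))) * indicator {1 - d..r} s \<partial>lborel)"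
    proof (rule nn_integral_mono)
      fix s
      show "(\<integral>\<^sup>+t. ennreal (?f t s) * indicator {1 - d..r} s * indicator S t \<partial>lborel)
          \<le> ennreal (\<mu> * m + C * ln (1 / (\<mu> * (1 - s)))) * indicator {1 - d..r} s"
      proof (cases "s \<in> {1 - d..r}")
        case True
        then have s: "0 < s" "s < 1" "1 - d \<le> s" "s \<le> r"
          using r d by auto
        let ?g = "\<lambda>t. norm (deriv bprod (of_real s * cis t))"
        have "(\<integral>\<^sup>+t. ennreal (?f t s) * indicator {1 - d..r} s * indicator S t \<partial>lborel)
            = (\<integral>\<^sup>+t. ennreal (?g t) * indicator S t \<partial>lborel)"
          using s by (simp add: max_absorb2 min_absorb2)
        \<comment> \<open>The levels are truncated at \<open>1 / (1 - s)\<close>, the Cauchy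
          estimate for the derivative.\<close>
        also have "\<dots> \<le> ennreal (\<mu> * m + C * ln (1 / (1 - s) / \<mu>))"
        proof (rule nn_integral_le_of_weak_type)
          show "?g \<in> borel_measurable borel"
            using s by (intro circle_compose_measurable continuous_on_norm cont) auto
          have "\<mu> * (1 - s) \<le> \<mu> * d"
            using s \<mu> by (intro mult_left_mono) auto
          then show "\<mu> \<le> 1 / (1 - s)"
            using s \<mu> c by (simp add: field_simps)
          show "?g t \<le> 1 / (1 - s)" for t
            using norm_deriv_bprod_le_inverse[of "of_real s * cis t"] s by (simp add: norm_mult)
          fix l :: real assume l: "0 < l"
          have 1: "circle_set (deriv bprod) s l \<in> sets borel"
            by (rule circle_set_borel[OF cont]) (use s in auto)
          have 2: "circle_set (deriv bprod) s l \<subseteq> {0..<2 * pi}"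
            unfolding circle_set_def by blast
          have "{t\<in>S. l < ?g t} \<subseteq> circle_set (deriv bprod) s l"
            unfolding circle_set_def using S(2) by blast
          then have "emeasure lborel {t\<in>S. l < ?g t} \<le> emeasure lborel (circle_set (deriv bprod) s l)"
            by (rule emeasure_mono) (simp only: sets_lborel 1)
          also have "\<dots> \<le> ennreal (C / l)"
            unfolding measure_subset_period(1)[OF 1 2] using s l by (intro ennreal_leI weak)
          finally show "emeasure lborel {t\<in>S. l < ?g t} \<le> ennreal (C / l)" .
        qed (use m \<mu> C S in auto)
        finally show ?thesis
          using True by (simp add: mult.commute)
      qed simp
    qed
    also have "\<dots> \<le> ennreal ((1 - (1 - d)) * (\<mu> * m + C * (1 - ln (\<mu> * (1 - (1 - d))))))"
      by (rule nn_integral_log_weight) (use r d \<mu> c m C in auto)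
    also have "(1 - (1 - d)) * (\<mu> * m + C * (1 - ln (\<mu> * (1 - (1 - d))))) =
        c / 2 * m + C * (1 + ln (2 / c)) * d"
    proof -
      have "ln (c / 2) = - ln (2 / c)"
        using c by (simp add: ln_div)
      moreover have "(1 - (1 - d)) * (\<mu> * m + C * (1 - ln (\<mu> * (1 - (1 - d))))) =
          \<mu> * d * m + C * (1 - ln (\<mu> * d)) * d"
        by (simp add: algebra_simps)
      ultimately show ?thesis
        unfolding \<mu>(2) by simp
    qed
    finally have "ennreal (c * m) \<le> ennreal e + ennreal (c / 2 * m + C * (1 + ln (2 / c)) * d)"
      by (simp add: add_left_mono add_right_mono)
    moreover have "0 \<le> c / 2 * m + C * (1 + ln (2 / c)) * d"
      using c m C d by (intro add_nonneg_nonneg mult_nonneg_nonneg) auto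
    ultimately show "c * m \<le> c / 2 * m + C * (1 + ln (2 / c)) * d + e"
      using e by (simp add: add.commute flip: ennreal_plus)
  qed
  then have "c / 2 * m \<le> C * (1 + ln (2 / c)) * d"
    by (simp add: field_simps)
  then have "m \<le> 2 * C / c * (1 + ln (2 / c)) * d"
    using c by (simp add: field_simps)
  then show ?thesis
    by (simp add: m_def)
qed

end

section \<open>Dyadic arcs and clusters of zeros\<close>

lemma norm_cis_diff_le: "norm (cis t - cis s) \<le> \<bar>t - s\<bar>"
proof -
  have "2 * \<bar>sin ((t - s) / 2)\<bar> \<le> 2 * \<bar>(t - s) / 2\<bar>"
    by (intro mult_left_mono abs_sin_x_le_abs_x) auto
  then show ?thesis
    unfolding norm_cis_diff by simp
qed

text \<open>The upper counterpart of \<open>norm_cis_Arg_diff_le\<close>: \<open>1 - q\<close>, with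
  \<open>q = norm a * r\<close>, is at most the sum of the two distances to the circle, and turning
  by the remaining angle costs at most that angle.\<close>

lemma norm_one_minus_cnj_mult_le:
  assumes "norm a < 1" "0 \<le> r" "r < 1"
  shows "norm (1 - cnj a * (of_real r * cis t)) \<le> (1 - norm a) + (1 - r) + \<bar>t - Arg2pi a\<bar>"
proof -
  define s where "s = Arg2pi a"
  define q where "q = norm a * r"
  have q: "0 \<le> q" "q \<le> 1"
    using assms by (auto simp: q_def mult_le_one)
  have a: "a = of_real (norm a) * cis s"
    using Arg2pi_eq[of a] by (simp add: s_def cis_conv_exp mult.commute)
  have "1 - cnj a * (of_real r * cis t) = of_real (1 - q) - of_real q * cis (- s) * (cis t - cis s)"
    by (subst a) (simp add: q_def cis_cnj cis_mult algebra_simps)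
  also have "norm \<dots> \<le> norm (complex_of_real (1 - q)) + norm (of_real q * cis (- s) * (cis t - cis s))"
    by (rule norm_triangle_ineq4)
  also have "\<dots> = (1 - q) + q * norm (cis t - cis s)"
    using q by (simp add: norm_mult del: of_real_diff)
  also have "q * norm (cis t - cis s) \<le> 1 * \<bar>t - s\<bar>"
    using q by (intro mult_mono norm_cis_diff_le) auto
  also have "1 - q \<le> (1 - norm a) + (1 - r)"
    using mult_nonneg_nonneg[of "1 - norm a" "1 - r"] assms by (simp add: q_def algebra_simps)
  finally show ?thesis
    by (simp add: s_def)
qed

text \<open>Half-open arcs, so that those with \<open>j < 2 ^ k\<close> partition one period and
  \<open>cell_index\<close> is a floor.\<close>

definition cell :: "nat \<Rightarrow> nat \<Rightarrow> real set" where
  "cell k j = {2 * pi * real j / 2 ^ k..<2 * pi * (real j + 1) / 2 ^ k}"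

definition cell_index :: "nat \<Rightarrow> complex \<Rightarrow> nat" where
  "cell_index k z = nat \<lfloor>Arg2pi z * 2 ^ k / (2 * pi)\<rfloor>"

lemma cell_index_less: "cell_index k z < 2 ^ k"
proof -
  have "Arg2pi z * 2 ^ k / (2 * pi) < 2 ^ k"
    using Arg2pi_lt_2pi[of z] by (simp add: field_simps)
  then show ?thesis
    by (simp add: cell_index_def floor_less_iff nat_less_iff)
qed

lemma Arg2pi_in_cell: "Arg2pi z \<in> cell k (cell_index k z)"
proof -
  define x where "x = Arg2pi z * 2 ^ k / (2 * pi)"
  have "0 \<le> x"
    using Arg2pi_ge_0[of z] by (simp add: x_def)
  then have "real (cell_index k z) \<le> x" "x < real (cell_index k z) + 1"
    unfolding cell_index_def x_def[symmetric] by linarith+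
  then show ?thesis
    by (simp add: x_def cell_def field_simps)
qed

lemma cell_subset: "j < 2 ^ k \<Longrightarrow> cell k j \<subseteq> {0..<2 * pi}"
proof
  fix t assume "j < 2 ^ k" and t: "t \<in> cell k j"
  then have "real j + 1 \<le> 2 ^ k"
    by (metis Suc_leI of_nat_Suc of_nat_le_iff of_nat_numeral of_nat_power add.commute)
  then have "2 * pi * (real j + 1) / 2 ^ k \<le> 2 * pi"
    by (simp add: divide_le_eq)
  moreover have "0 \<le> 2 * pi * real j / 2 ^ k"
    by simp
  ultimately show "t \<in> {0..<2 * pi}"
    using t unfolding cell_def atLeastLessThan_iff by linarith
qed

lemma cell_diff_le: "s \<in> cell k j \<Longrightarrow> t \<in> cell k j \<Longrightarrow> \<bar>t - s\<bar> \<le> 2 * pi / 2 ^ k"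
  by (auto simp: cell_def add_divide_distrib distrib_left)

lemma cell_borel: "cell k j \<in> sets borel"
  by (simp add: cell_def)

lemma measure_cell: "measure lebesgue (cell k j) = 2 * pi / 2 ^ k"
  by (simp add: cell_def divide_right_mono diff_divide_distrib[symmetric] distrib_left)

lemma disjoint_cells: "disjoint_family (cell k)"
  unfolding disjoint_family_on_def
proof (intro ballI impI)
  fix i j :: nat assume "i \<noteq> j"
  moreover have "cell k i \<inter> cell k j = {}" if "i < j" for i j
  proof -
    have "real i + 1 \<le> real j"
      using that by simp
    then have "2 * pi * (real i + 1) / 2 ^ k \<le> 2 * pi * real j / 2 ^ k"
      by (intro divide_right_mono mult_left_mono) auto
    then show ?thesis
      by (auto simp: cell_def)
  qed
  ultimately show "cell k i \<inter> cell k j = {}"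
    by (metis Int_commute linorder_neqE_nat)
qed

context blaschke_zeros
begin

text \<open>Each zero of the cluster lowers the squared modulus by a factor \<open>1 - x\<close>
  with \<open>x\<close> of order \<open>1 / m\<close>; at least \<open>m\<close> such factors give a
  loss independent of \<open>m\<close> and \<open>k\<close>.\<close>

lemma norm_bprod_le_near_cluster:
  assumes F: "finite F" "F \<subseteq> dyadic_index k" "\<And>n. n \<in> F \<Longrightarrow> cell_index k (a n) = j"
    and m: "1 \<le> m" "m \<le> real (card F)" and k: "1 \<le> k" and t: "t \<in> cell k j"
  shows "norm (bprod (of_real (1 - 1 / (2 ^ k * m)) * cis t)) \<le> 1 - 1 / 326"
proof -
  define h where "h = 1 / (2::real) ^ k"
  define d where "d = h / m"
  let ?w = "of_real (1 - d) * cis t"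
  have h: "0 < h" "h \<le> 1 / 2"
    using k power_increasing[of 1 k "2::real"] by (auto simp: h_def field_simps)
  have d: "0 < d" "d \<le> h" "d < 1"
  proof -
    show "0 < d" using h m by (simp add: d_def)
    show "d \<le> h" using h m by (simp add: d_def field_simps)
    then show "d < 1" using h by simp
  qed
  have w: "norm ?w < 1" "norm ?w = 1 - d"
    using d by (simp_all add: norm_mult del: of_real_diff)
  \<comment> \<open>This is \<open>(h / 2) * d / (9 * h)\<^sup>2\<close>, the lower bound for the
    defect of a single factor.\<close>
  define x where "x = 1 / (162 * m)"
  have x: "0 < x" "x \<le> 1"
    using m by (auto simp: x_def field_simps)
  have fac_le: "(norm (fac n ?w))\<^sup>2 \<le> 1 - x" if n: "n \<in> F" for n
  proof -
    have n': "n \<in> I" "h / 2 \<le> 1 - norm (a n)" "1 - norm (a n) \<le> h"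
      using n F(2) by (auto simp: dyadic_index_def h_def)
    have an: "norm (a n) < 1"
      by (rule zero_norm_less_1[OF n'(1)])
    have "\<bar>t - Arg2pi (a n)\<bar> \<le> 2 * pi * h"
      using cell_diff_le[OF Arg2pi_in_cell, of t k "a n"] t F(3)[OF n] by (simp add: h_def)
    also have "\<dots> \<le> 7 * h"
      using h pi_less_4 pi_approx by (intro mult_right_mono) auto
    \<comment> \<open>One \<open>h\<close> each for the depth of the zero and for \<open>d\<close>,
      and \<open>7 * h\<close> for the angle.\<close>
    finally have "norm (1 - cnj (a n) * ?w) \<le> 9 * h"
      using norm_one_minus_cnj_mult_le[OF an, of "1 - d" t] d n' by simp
    then have q: "(norm (1 - cnj (a n) * ?w))\<^sup>2 \<le> (9 * h)\<^sup>2"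
      by (rule power_mono) simp
    have q0: "0 < (norm (1 - cnj (a n) * ?w))\<^sup>2"
      using norm_one_minus_ge(3)[OF an w(1)] by simp
    have "x = (h / 2) * d / (9 * h)\<^sup>2"
      using h m by (simp add: x_def d_def power2_eq_square)
    also have "\<dots> \<le> (1 - (norm (a n))\<^sup>2) * (1 - (norm ?w)\<^sup>2) / (norm (1 - cnj (a n) * ?w))\<^sup>2"
    proof (rule frac_le[OF _ _ q0 q])
      have sq: "1 - y \<le> 1 - y\<^sup>2" if "0 \<le> y" "y \<le> 1" for y :: real
        using that by (simp add: power2_eq_square mult_left_le_one_le)
      have "h / 2 \<le> 1 - (norm (a n))\<^sup>2"
        using sq[of "norm (a n)"] n' an by simp
      moreover have "d \<le> 1 - (norm ?w)\<^sup>2"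
        using sq[of "1 - d"] d unfolding w(2) by simp
      ultimately show "h / 2 * d \<le> (1 - (norm (a n))\<^sup>2) * (1 - (norm ?w)\<^sup>2)"
        using h d by (intro mult_mono) auto
      have "(norm (a n))\<^sup>2 \<le> 1" "(norm ?w)\<^sup>2 \<le> 1"
        by (rule power_le_one[OF norm_ge_zero less_imp_le], rule an w(1))+
      then show "0 \<le> (1 - (norm (a n))\<^sup>2) * (1 - (norm ?w)\<^sup>2)"
        by (intro mult_nonneg_nonneg) (simp_all only: diff_ge_0_iff_ge)
    qed
    also have "\<dots> = 1 - (norm (fac n ?w))\<^sup>2"
      using one_minus_norm_blaschke_factor_sq[OF an w(1)] n'(1) by (simp add: fac_def)
    finally show ?thesis by simp
  qed
  have "(norm (bprod ?w))\<^sup>2 \<le> (\<Prod>n\<in>F. norm (fac n ?w))\<^sup>2"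
    by (intro power_mono norm_bprod_le_prod F w) auto
  also have "\<dots> = (\<Prod>n\<in>F. (norm (fac n ?w))\<^sup>2)"
    by (simp add: prod_power_distrib)
  also have "\<dots> \<le> (\<Prod>n\<in>F. 1 - x)"
    by (intro prod_mono) (use fac_le in auto)
  also have "\<dots> = (1 - x) ^ card F"
    by simp
  also have "\<dots> \<le> exp (- x) ^ card F"
    using x exp_ge_add_one_self[of "- x"] by (intro power_mono) auto
  also have "\<dots> = exp (- (x * real (card F)))"
    by (simp add: exp_of_nat_mult[symmetric] mult.commute)
  also have "\<dots> \<le> exp (- (1 / 162))"
  proof -
    have "x * m \<le> x * real (card F)"
      using x m by (intro mult_left_mono) auto
    moreover have "x * m = 1 / 162"
      using m by (simp add: x_def)
    ultimately show ?thesis by simp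
  qed
  also have "\<dots> = 1 / exp (1 / 162)"
    by (simp add: exp_minus inverse_eq_divide)
  also have "\<dots> \<le> 1 / (1 + 1 / 162)"
    using exp_ge_add_one_self[of "1 / 162"] by (intro divide_left_mono) auto
  \<comment> \<open>The left side equals \<open>1 - 1 / 163\<close>, and
    \<open>326 = 2 * 163\<close>, so squaring only adds a positive term.\<close>
  also have "\<dots> \<le> (1 - 1 / 326 :: real)\<^sup>2"
    by (simp add: power2_eq_square)
  finally have "norm (bprod ?w) \<le> 1 - 1 / 326"
    by (rule power2_le_imp_le) simp
  then show ?thesis
    by (simp add: d_def h_def)
qed

lemma dyadic_bound_of_weak_type:
  assumes weak: "\<And>r l. 0 < r \<Longrightarrow> r < 1 \<Longrightarrow> 0 < l \<Longrightarrow> measure lebesgue (circle_set (deriv bprod) r l) \<le> C / l"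
    and C: "0 \<le> C"
  shows "\<exists>M. \<forall>k\<ge>1. real (card (dyadic_index k)) \<le> M"
proof -
  \<comment> \<open>The constant of \<open>measure_le_of_weak_type\<close> for
    \<open>c = 1 / 326\<close>, divided by \<open>2 * pi\<close> so that lengths compare directly
    with the cell length \<open>2 * pi / 2 ^ k\<close>.\<close>
  define K where "K = 2 * C / (1 / 326) * (1 + ln (2 / (1 / 326))) / (2 * pi)"
  show ?thesis
  proof (intro exI allI impI)
    fix k :: nat assume k: "1 \<le> k"
    define D where "D = dyadic_index k"
    define J where "J = (\<lambda>n. cell_index k (a n)) ` D"
    define F where "F j = {n\<in>D. cell_index k (a n) = j}" for j
    have fin: "finite D" "finite J" "finite (F j)" for j
      by (simp_all add: D_def J_def F_def finite_dyadic_index)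
    \<comment> \<open>Used twice: for a single occupied cell with \<open>m\<close> its number of
      zeros, and for all occupied cells with \<open>m = 1\<close>.\<close>
    have le: "measure lebesgue S \<le> 2 * pi * K * (1 / (2 ^ k * m))"
      if S: "S = (\<Union>j\<in>J'. cell k j)" and J': "J' \<subseteq> J" and m: "1 \<le> m" "\<And>j. j \<in> J' \<Longrightarrow> m \<le> real (card (F j))"
      for S m J'
    proof -
      have "measure lebesgue S \<le> 2 * C / (1 / 326) * (1 + ln (2 / (1 / 326))) * (1 / (2 ^ k * m))"
      proof (rule measure_le_of_weak_type[OF weak C])
        have "2 ^ 1 * 1 \<le> 2 ^ k * m"
          using k m by (intro mult_mono power_increasing) auto
        then show "0 < 1 / (2 ^ k * m)" "1 / (2 ^ k * m) < 1"
          by (auto simp: divide_less_eq)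
        show "S \<in> sets borel"
          unfolding S using fin(2) J' cell_borel finite_subset by (intro sets.finite_UN) auto
        have "j < 2 ^ k" if "j \<in> J'" for j
          using that J' cell_index_less unfolding J_def by blast
        then show "S \<subseteq> {0..<2 * pi}"
          unfolding S by (intro UN_least cell_subset)
        fix t assume "t \<in> S"
        then obtain j where j: "j \<in> J'" "t \<in> cell k j"
          using S by auto
        show "norm (bprod (of_real (1 - 1 / (2 ^ k * m)) * cis t)) \<le> 1 - 1 / 326"
          by (rule norm_bprod_le_near_cluster[OF fin(3)[of j] _ _ m(1) m(2)[OF j(1)] k j(2)])
             (auto simp: F_def D_def)
      qed auto
      then show ?thesis
        by (simp add: K_def)
    qed
    have card_F: "real (card (F j)) \<le> K" if j: "j \<in> J" for j
    proof -
      have "F j \<noteq> {}"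
        using j by (auto simp: F_def J_def)
      then have c: "1 \<le> real (card (F j))"
        using fin(3)[of j] by (simp add: Suc_le_eq card_gt_0_iff)
      have "2 * pi / 2 ^ k \<le> 2 * pi * K * (1 / (2 ^ k * real (card (F j))))"
        using le[of _ "{j}", OF refl _ c] j by (simp add: measure_cell)
      then show ?thesis
        using c by (simp add: field_simps)
    qed
    have card_J: "real (card J) \<le> K"
    proof -
      have "measure lebesgue (\<Union>j\<in>J. cell k j) = (\<Sum>j\<in>J. measure lebesgue (cell k j))"
      proof (rule measure_finite_Union[OF fin(2)])
        \<comment> \<open>An infinite value would make \<open>measure\<close> equal to 0, against
          the positive length of a cell.\<close>
        show "emeasure lebesgue (cell k j) \<noteq> \<infinity>" for j
          using measure_cell[of k j] by (auto simp: measure_def)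
        show "disjoint_family_on (cell k) J"
          by (rule disjoint_family_on_mono[OF subset_UNIV disjoint_cells])
      qed (use cell_borel in auto)
      moreover have "1 \<le> real (card (F j))" if "j \<in> J" for j
      proof -
        have "F j \<noteq> {}"
          using that by (auto simp: F_def J_def)
        then show ?thesis
          using fin(3)[of j] by (simp add: Suc_le_eq card_gt_0_iff)
      qed
      ultimately have "real (card J) * (2 * pi / 2 ^ k) \<le> 2 * pi * K * (1 / (2 ^ k * 1))"
        using le[of _ J 1, OF refl] by (simp add: measure_cell)
      then show ?thesis
        by (simp add: field_simps)
    qed
    have "real (card D) = (\<Sum>n\<in>D. 1)"
      by simp
    also have "\<dots> = (\<Sum>j\<in>J. real (card (F j)))"
      unfolding J_def F_def using sum.image_gen[OF fin(1), of "\<lambda>_. 1::real" "\<lambda>n. cell_index k (a n)"] by simp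
    also have "\<dots> \<le> real (card J) * K"
      using sum_bounded_above[of J "\<lambda>j. real (card (F j))" K] card_F by simp
    also have "\<dots> \<le> K * K"
      using card_J by (intro mult_right_mono) (auto intro: order_trans[OF of_nat_0_le_iff])
    finally show "real (card (dyadic_index k)) \<le> K * K"
      by (simp add: D_def)
  qed
qed

end

theorem theorem1:
  fixes B :: "complex \<Rightarrow> complex"
  assumes "blaschke_product B"
  shows "deriv B \<in> weak_hardy 1 \<longleftrightarrow> exponential_blaschke_product B"
proof -
  obtain I a where "blaschke_zeros I a" and B: "\<And>w. norm w < 1 \<Longrightarrow> B w = blaschke_zeros.bprod I a w"
    using blaschke_product_imp_zeros[OF assms] by blast
  then interpret blaschke_zeros I a
    by simp
  \<comment> \<open>\<open>B\<close> is known only inside the disc, but the disc is open, so the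
    derivatives agree there.\<close>
  have deriv_eq: "deriv B w = deriv bprod w" if "norm w < 1" for w
    using that B by (intro complex_derivative_transform_within_open[of _ "ball 0 1"])
      (auto intro: holomorphic_transform[OF bprod_holomorphic] bprod_holomorphic)
  have "deriv B holomorphic_on ball 0 1 \<longleftrightarrow> deriv bprod holomorphic_on ball 0 1"
    by (intro holomorphic_cong) (auto simp: deriv_eq)
  then have analytic: "deriv B analytic_on ball 0 1"
    using holomorphic_deriv[OF bprod_holomorphic open_ball] by (simp add: analytic_on_open)
  have set_eq: "circle_set (deriv B) r l = circle_set (deriv bprod) r l" if "0 < r" "r < 1" for r l
    using that by (auto simp: circle_set_def deriv_eq norm_mult)
  have weak_iff: "deriv B \<in> weak_hardy 1 \<longleftrightarrow> (\<exists>C>0. \<forall>r l. 0 < r \<longrightarrow> r < 1 \<longrightarrow> 0 < l \<longrightarrow>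
      measure lebesgue (circle_set (deriv bprod) r l) \<le> C / l)"
    unfolding weak_hardy_def circle_length_eq
    using analytic by (auto simp: set_eq powr_minus_divide)
  have exp_iff: "exponential_blaschke_product B \<longleftrightarrow>
      (\<exists>M>0. \<forall>k\<ge>1. real (card (dyadic_index k)) \<le> M)"
    unfolding exponential_blaschke_product_def
    using assms by (simp add: sum_zorder_dyadic_zeros[OF B])
  show ?thesis
    unfolding weak_iff exp_iff
  proof
    assume "\<exists>C>0. \<forall>r l. 0 < r \<longrightarrow> r < 1 \<longrightarrow> 0 < l \<longrightarrow>
      measure lebesgue (circle_set (deriv bprod) r l) \<le> C / l"
    then obtain M where M: "\<forall>k\<ge>1. real (card (dyadic_index k)) \<le> M"
      using dyadic_bound_of_weak_type by (metis less_imp_le)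
    then show "\<exists>M>0. \<forall>k\<ge>1. real (card (dyadic_index k)) \<le> M"
      by (intro exI[of _ "max 1 M"]) (auto simp: le_max_iff_disj)
  next
    assume "\<exists>M>0. \<forall>k\<ge>1. real (card (dyadic_index k)) \<le> M"
    then obtain M where M: "0 < M" "\<And>k. 1 \<le> k \<Longrightarrow> real (card (dyadic_index k)) \<le> M"
      by blast
    \<comment> \<open>The exponential condition starts at \<open>k = 1\<close>, whereas the weak
      type lemma asks for a bound at every \<open>k\<close>; the finite count at
      \<open>k = 0\<close> is absorbed into the constant.\<close>
    define M' where "M' = max M (real (card (dyadic_index 0)))"
    have "real (card (dyadic_index k)) \<le> M'" for k
      using M(2)[of k] by (cases k) (auto simp: M'_def le_max_iff_disj)
    moreover have "0 < M'"
      using M by (auto simp: M'_def)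
    ultimately show "\<exists>C>0. \<forall>r l. 0 < r \<longrightarrow> r < 1 \<longrightarrow> 0 < l \<longrightarrow>
      measure lebesgue (circle_set (deriv bprod) r l) \<le> C / l"
      using weak_type_of_dyadic_bound[of M']
      by (intro exI[of _ "48 * pi * M' + 864 * pi * M'\<^sup>2"]) (auto intro: add_pos_nonneg)
  qed
qed

end
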